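(* Let $d\ge2$, $1\le k\le d$ and $n\ge1$ be integers, and let $x_1,\ldots,x_n$ be deterministic vectors in $\mathbb{R}^d$. Define $\sigma>0$ by $\frac1n\sum_{i=1}^n|x_i|^2=\sigma^2d$, and let $A:=\frac1n\sum_{i=1}^n\left|\sigma^{-2}|x_i|^2-d\right|$. For $\theta=(\theta_1,\ldots,\theta_k)\in\mathfrak{W}_{d,k}$ let $$\mu_{n,d,k}^\theta:=\frac1n\sum_{i=1}^n\delta_{(\langle\theta_1,x_i\rangle,\ldots,\langle\theta_k,x_i\rangle)}.$$ If $\theta$ is a random point of $\mathfrak{W}_{d,k}$ distributed according to Haar measure, $X_\theta$ is distributed according to $\mu_{n,d,k}^\theta$ (conditionally on $\theta$), and $Z$ is a standard normal random vector in $\mathbb{R}^k$, then $$d_W(X_\theta,\sigma Z)\le\frac{\sigma\sqrt{k}(A+1)+\sigma k}{d-1},$$ where the law of $X_\theta$ is the unconditional one (averaged over $\theta$).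
   Context: $|\cdot|$ denotes the Euclidean norm and $\delta_y$ the unit point mass at $y$. The Stiefel manifold is $\mathfrak{W}_{d,k}=\{\theta=(\theta_1,\ldots,\theta_k):\theta_i\in\mathbb{R}^d,\ \langle\theta_i,\theta_j\rangle=\delta_{ij}\text{ for all }1\le i,j\le k\}$; Haar measure on it is the unique rotation-invariant probability measure. The Wasserstein distance between random vectors $U,V$ in $\mathbb{R}^k$ is $d_W(U,V)=\sup\{|\mathbb{E}f(V)-\mathbb{E}f(U)|: f:\mathbb{R}^k\to\mathbb{R},\ |f(x)-f(y)|\le|x-y|\text{ for all }x,y\}$. *)

theory Defs
  imports "HOL-Probability.Probability"
begin

(* A point of R^d is an element of real^'d. A k-tuple of such points is an element of real^'d^'k,
   with theta $ j its j-th member. *)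

definition stiefel :: "(real^'d^'k) set" where
  "stiefel = {\<theta>. \<forall>i j. \<theta> $ i \<bullet> \<theta> $ j = (if i = j then 1 else 0)}"

abbreviation stiefel_borel :: "(real^'d^'k) measure" where
  "stiefel_borel \<equiv> restrict_space borel stiefel"

(* Invariance is required under the full orthogonal group: for k = d the subgroup of determinant 1
   does not act transitively on the Stiefel manifold, so it would not determine the measure. *)

definition haar_stiefel :: "(real^'d^'k) measure \<Rightarrow> bool" where
  "haar_stiefel H \<longleftrightarrow> prob_space H \<and> sets H = sets stiefel_borel \<and>
     (\<forall>U. orthogonal_transformation U \<longrightarrow> distr H H (\<lambda>\<theta>. \<chi> j. U (\<theta> $ j)) = H)"

definition proj_empirical ::
    "nat \<Rightarrow> (nat \<Rightarrow> real^'d) \<Rightarrow> real^'d^'k \<Rightarrow> (real^'k) measure" where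
  "proj_empirical n x \<theta> =
     distr (uniform_count_measure {1..n}) borel (\<lambda>i. \<chi> j. \<theta> $ j \<bullet> x i)"

lemma emeasure_proj_empirical:
  fixes x :: "nat \<Rightarrow> real^'d" and \<theta> :: "real^'d^'k"
  assumes "n \<ge> 1" and B: "B \<in> sets borel"
  shows "emeasure (proj_empirical n x \<theta>) B =
    (\<Sum>i=1..n. emeasure (return borel (\<chi> j. \<theta> $ j \<bullet> x i)) B) / of_nat n"
proof -
  let ?f = "\<lambda>i. \<chi> j. \<theta> $ j \<bullet> x i"
  have "emeasure (proj_empirical n x \<theta>) B =
      emeasure (uniform_count_measure {1..n}) (?f -` B \<inter> {1..n})"
    unfolding proj_empirical_def
    by (subst emeasure_distr) (auto simp: B space_uniform_count_measure sets_uniform_count_measure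
          measurable_def)
  also have "\<dots> = of_nat (card (?f -` B \<inter> {1..n})) / of_nat n"
    using assms by (subst emeasure_uniform_count_measure)
      (auto simp: divide_ennreal[symmetric] ennreal_of_nat_eq_real_of_nat)
  also have "of_nat (card (?f -` B \<inter> {1..n})) = (\<Sum>i=1..n. indicator B (?f i) :: ennreal)"
    by (simp add: indicator_def sum.If_cases Int_commute vimage_def Collect_conj_eq)
  finally show ?thesis using B by simp
qed

(* K is a regular conditional distribution of X given Y. *)

definition conditional_law ::
    "'a measure \<Rightarrow> 'b measure \<Rightarrow> ('a \<Rightarrow> 'b) \<Rightarrow> 'c measure \<Rightarrow> ('a \<Rightarrow> 'c) \<Rightarrow> ('b \<Rightarrow> 'c measure) \<Rightarrow> bool" where
  "conditional_law M S Y T X K \<longleftrightarrow>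
     Y \<in> M \<rightarrow>\<^sub>M S \<and> X \<in> M \<rightarrow>\<^sub>M T \<and> K \<in> S \<rightarrow>\<^sub>M prob_algebra T \<and>
     (\<forall>A\<in>sets S. \<forall>B\<in>sets T.
        emeasure M {\<omega> \<in> space M. Y \<omega> \<in> A \<and> X \<omega> \<in> B} =
        (\<integral>\<^sup>+ y\<in>A. emeasure (K y) B \<partial>distr M S Y))"

(* Shows that the kernel requirement in conditional_law is no restriction for proj_empirical. *)

lemma proj_empirical_kernel:
  fixes x :: "nat \<Rightarrow> real^'d"
  assumes "n \<ge> 1"
  shows "proj_empirical n x \<in> (stiefel_borel :: (real^'d^'k) measure) \<rightarrow>\<^sub>M prob_algebra borel"
proof (rule measurable_prob_algebraI)
  fix \<theta> :: "real^'d^'k"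
  show "prob_space (proj_empirical n x \<theta>)"
    unfolding proj_empirical_def using assms
    by (intro prob_space.prob_space_distr prob_space_uniform_count_measure)
       (auto simp: measurable_def space_uniform_count_measure sets_uniform_count_measure)
next
  show "proj_empirical n x \<in> (stiefel_borel :: (real^'d^'k) measure) \<rightarrow>\<^sub>M subprob_algebra borel"
  proof (rule measurable_subprob_algebra)
    fix \<theta> :: "real^'d^'k"
    show "subprob_space (proj_empirical n x \<theta>)"
      unfolding proj_empirical_def using assms
      by (intro prob_space_imp_subprob_space prob_space.prob_space_distr
            prob_space_uniform_count_measure)
         (auto simp: measurable_def space_uniform_count_measure sets_uniform_count_measure)
    show "sets (proj_empirical n x \<theta>) = sets borel"
      by (simp add: proj_empirical_def)
  next
    fix B :: "(real^'k) set" assume B[measurable]: "B \<in> sets borel"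
    have [measurable]: "(\<lambda>\<theta> :: real^'d^'k. \<chi> j. \<theta> $ j \<bullet> x i) \<in> borel_measurable borel" for i
      by (intro borel_measurable_continuous_onI continuous_intros)
    show "(\<lambda>\<theta>. emeasure (proj_empirical n x \<theta>) B)
        \<in> borel_measurable (stiefel_borel :: (real^'d^'k) measure)"
      unfolding emeasure_proj_empirical[OF assms B]
      by (rule measurable_restrict_space1) (use B in simp)
  qed
qed

definition std_normal_vector :: "'a measure \<Rightarrow> ('a \<Rightarrow> real^'k) \<Rightarrow> bool" where
  "std_normal_vector M Z \<longleftrightarrow>
     prob_space.indep_vars M (\<lambda>_. borel) (\<lambda>j \<omega>. Z \<omega> $ j) UNIV \<and>
     (\<forall>j. distributed M lborel (\<lambda>\<omega>. Z \<omega> $ j) std_normal_density)"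

(* The expectations exist for all 1-Lipschitz f exactly when both vectors are integrable. Outside
   that case the value is infinity, so that a finite bound never rests on the convention that the
   Bochner integral of a non-integrable function is 0. *)

definition wasserstein ::
    "'a measure \<Rightarrow> ('a \<Rightarrow> 'c::euclidean_space) \<Rightarrow> 'b measure \<Rightarrow> ('b \<Rightarrow> 'c) \<Rightarrow> ereal" where
  "wasserstein M U N V =
     (if integrable M U \<and> integrable N V
      then (SUP f\<in>{f. 1-lipschitz_on UNIV f}.
              ereal \<bar>(\<integral>\<omega>. f (V \<omega>) \<partial>N) - (\<integral>\<omega>. f (U \<omega>) \<partial>M)\<bar>)
      else \<infinity>)"

end

theory Submission
  imports Defs "HOL-Real_Asymp.Real_Asymp"
begin

text \<open>
  Fix a coordinate \<open>a\<close> and let \<open>w \<in> \<real>\<^sup>k\<close> be the column of the \<open>a\<close>-th coordinates of \<open>\<theta>\<^sub>1, \<dots>, \<theta>\<^sub>k\<close>. Rotation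
  invariance shows that the projection of \<open>x\<^sub>i\<close> has the law of \<open>\<bar>x\<^sub>i\<bar> w\<close> (\<open>haar_stiefel_inner_law\<close>). Hence, for a
  \<open>1\<close>-Lipschitz \<open>f\<close>, the expectation \<open>E f(X)\<close> is the average over \<open>i\<close> of \<open>E f(\<bar>x\<^sub>i\<bar> w)\<close>. Replacing each \<open>\<bar>x\<^sub>i\<bar>\<close> by
  \<open>\<sigma> sqrt d\<close> costs at most \<open>\<bar>\<bar>x\<^sub>i\<bar> - \<sigma> sqrt d\<bar> E\<bar>w\<bar>\<close>, and as \<open>E\<bar>w\<bar>\<^sup>2 = k / d\<close>, the average of these costs is at most
  \<open>\<sigma> sqrt k A / d\<close>.

  It remains to compare \<open>Y = sqrt d w\<close> with a standard Gaussian vector \<open>Z\<close> at a cost of \<open>(k + sqrt k) / (d - 1)\<close>,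
  which scaling multiplies by \<open>\<sigma>\<close>.
  This is Stein's method in the form of two integration by parts formulas,

    \<open>(d - 1) E [(z \<bullet> w) g(w)] = E [(z - (z \<bullet> w) w) \<bullet> \<nabla>g(w)]\<close>   and   \<open>E [(v \<bullet> Z) g(Z)] = E [v \<bullet> \<nabla>g(Z)]\<close>.

  The first expresses invariance under infinitesimal rotations of \<open>\<real>\<^sup>d\<close> (\<open>stiefel_column_stein_identity\<close>).
  The second is the usual Gaussian formula. Along the path
  \<open>Y\<^sub>s = cos s Y + sin s Z\<close> from \<open>Y\<close> to \<open>Z\<close> the two formulas combine to

    \<open>d/ds E f(Y\<^sub>s) = cos s / (d - 1) * E [((Z \<bullet> Y) Y - Z) \<bullet> \<nabla>f(Y\<^sub>s)]\<close>,

  and \<open>\<bar>\<nabla>f\<bar> \<le> 1\<close>, \<open>E \<bar>Z \<bullet> Y\<bar> \<bar>Y\<bar> \<le> k\<close>, \<open>E \<bar>Z\<bar> \<le> sqrt k\<close> finish the estimate (\<open>stein_smart_path_bound\<close>). No second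
  derivative of \<open>f\<close> remains, so approximating Lipschitz functions by continuously differentiable ones with
  the same Lipschitz constant loses nothing (\<open>smooth_approximation\<close>).
\<close>

section \<open>Functions with bounded continuous gradient\<close>

text \<open>
  The mean value theorem bounds every difference quotient by the same integrable \<open>B\<close>, so dominated
  convergence applies along any sequence tending to \<open>0\<close>; the derivative is measurable as a limit of the same
  quotients.
\<close>

lemma has_real_derivative_integral_dominated:
  fixes h h' :: "real \<Rightarrow> 'a \<Rightarrow> real"
  assumes int: "\<And>t. integrable M (h t)"
    and der: "\<And>t \<omega>. \<omega> \<in> space M \<Longrightarrow> ((\<lambda>t. h t \<omega>) has_real_derivative h' t \<omega>) (at t)"
    and bound: "\<And>t \<omega>. \<omega> \<in> space M \<Longrightarrow> \<bar>h' t \<omega>\<bar> \<le> B \<omega>"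
    and B: "integrable M B"
  shows "((\<lambda>t. \<integral>\<omega>. h t \<omega> \<partial>M) has_real_derivative (\<integral>\<omega>. h' t \<omega> \<partial>M)) (at t)"
proof -
  have quotient_bound: "\<bar>(h (t + s) \<omega> - h t \<omega>) / s\<bar> \<le> B \<omega>" if "\<omega> \<in> space M" "s \<noteq> 0" for s \<omega>
  proof -
    have "norm (h (t + s) \<omega> - h t \<omega>) \<le> B \<omega> * norm (t + s - t)"
      by (rule field_differentiable_bound[where S=UNIV and f'="\<lambda>t. h' t \<omega>"])
        (use der[OF that(1)] bound[OF that(1)] in auto)
    then show ?thesis using that by (simp add: field_simps)
  qed
  have "(\<lambda>s. ((\<integral>\<omega>. h (t + s) \<omega> \<partial>M) - (\<integral>\<omega>. h t \<omega> \<partial>M)) / s) \<midarrow>0\<rightarrow> (\<integral>\<omega>. h' t \<omega> \<partial>M)"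
    unfolding tendsto_at_iff_sequentially
  proof (intro allI impI)
    fix X :: "nat \<Rightarrow> real" assume X: "\<forall>i. X i \<in> UNIV - {0}" "X \<longlonglongrightarrow> 0"
    have lim: "(\<lambda>i. (h (t + X i) \<omega> - h t \<omega>) / X i) \<longlonglongrightarrow> h' t \<omega>" if "\<omega> \<in> space M" for \<omega>
      using der[OF that, of t] X unfolding DERIV_def tendsto_at_iff_sequentially by (auto simp: comp_def)
    have meas: "(\<lambda>\<omega>. (h (t + X i) \<omega> - h t \<omega>) / X i) \<in> borel_measurable M" for i
      using int[THEN borel_measurable_integrable] by measurable
    have "(\<lambda>i. \<integral>\<omega>. (h (t + X i) \<omega> - h t \<omega>) / X i \<partial>M) \<longlonglongrightarrow> (\<integral>\<omega>. h' t \<omega> \<partial>M)"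
    proof (rule integral_dominated_convergence[where w=B])
      show "h' t \<in> borel_measurable M"
        by (rule borel_measurable_LIMSEQ_real[OF lim meas])
    qed (use meas lim quotient_bound X B in auto)
    then show "((\<lambda>s. ((\<integral>\<omega>. h (t + s) \<omega> \<partial>M) - (\<integral>\<omega>. h t \<omega> \<partial>M)) / s) \<circ> X) \<longlonglongrightarrow> (\<integral>\<omega>. h' t \<omega> \<partial>M)"
      using int by (simp add: comp_def)
  qed
  then show ?thesis unfolding DERIV_def .
qed

lemma lebesgue_integral_norm_bound:
  fixes f :: "'a \<Rightarrow> 'b::{banach, second_countable_topology}"
  assumes "integrable M f" "integrable M B" "\<And>x. x \<in> space M \<Longrightarrow> norm (f x) \<le> B x"
  shows "norm (\<integral>x. f x \<partial>M) \<le> (\<integral>x. B x \<partial>M)"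
  using assms by (intro order_trans[OF integral_norm_bound] integral_mono) auto

text \<open>
  The arithmetic-geometric mean inequality in the form that turns a bound on \<open>E T\<^sup>2\<close> into the bound
  \<open>sqrt (E T\<^sup>2)\<close> on \<open>E T\<close>: choose \<open>s = sqrt (E T\<^sup>2)\<close>.
\<close>

lemma le_average_square_quotient:
  fixes s t :: real
  assumes "s > 0"
  shows "t \<le> (t\<^sup>2 / s + s) / 2"
  using sum_squares_bound[of t s] assms by (simp add: field_simps power2_eq_square)

text \<open>
  The test functions for all integration by parts formulas below. The gradient is an explicit parameter
  because it appears inside expectations, and the constant \<open>L\<close> must survive the substitution
  \<open>x \<mapsto> c x + z\<close>, which multiplies it by \<open>\<bar>c\<bar>\<close>.
\<close>

definition bounded_gradient :: "real \<Rightarrow> ('a::euclidean_space \<Rightarrow> real) \<Rightarrow> ('a \<Rightarrow> 'a) \<Rightarrow> bool" where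
  "bounded_gradient L g G \<longleftrightarrow>
     (\<forall>x. GDERIV g x :> G x) \<and> continuous_on UNIV G \<and> (\<forall>x. norm (G x) \<le> L)"

lemma bounded_gradientD:
  assumes "bounded_gradient L g G"
  shows "(g has_derivative (\<lambda>h. h \<bullet> G x)) (at x)" "continuous_on UNIV G" "norm (G x) \<le> L"
    "0 \<le> L" "continuous_on UNIV g"
proof -
  show 1: "(g has_derivative (\<lambda>h. h \<bullet> G x)) (at x)" "continuous_on UNIV G" "norm (G x) \<le> L" for x
    using assms by (auto simp: bounded_gradient_def gderiv_def)
  show "0 \<le> L" using 1(3) norm_ge_zero order_trans by blast
  show "continuous_on UNIV g"
    using 1(1) by (intro continuous_at_imp_continuous_on ballI has_derivative_continuous)
qed

lemma bounded_gradient_measurable: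
  assumes "bounded_gradient L g G"
  shows "g \<in> borel_measurable borel" "G \<in> borel_measurable borel"
  using bounded_gradientD[OF assms] by (auto intro: borel_measurable_continuous_onI)

lemma bounded_gradient_Lipschitz:
  assumes "bounded_gradient L g G"
  shows "\<bar>g x - g y\<bar> \<le> L * norm (x - y)"
proof -
  have "norm (g x - g y) \<le> L * norm (x - y)"
  proof (rule differentiable_bound[where S=UNIV and f'="\<lambda>x h. h \<bullet> G x"])
    show "onorm (\<lambda>h. h \<bullet> G x) \<le> L" for x
    proof (rule onorm_bound)
      show "norm (h \<bullet> G x) \<le> L * norm h" for h
        using Cauchy_Schwarz_ineq2[of h "G x"] mult_left_mono[OF bounded_gradientD(3)[OF assms, of x], of "norm h"]
        by (simp add: mult.commute)
    qed (rule bounded_gradientD(4)[OF assms])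
  qed (use bounded_gradientD[OF assms] in auto)
  then show ?thesis by simp
qed

lemma bounded_gradient_growth:
  assumes "bounded_gradient L g G"
  shows "\<bar>g x\<bar> \<le> \<bar>g 0\<bar> + L * norm x"
  using bounded_gradient_Lipschitz[OF assms, of x 0] by simp

lemma bounded_gradient_affine:
  assumes "bounded_gradient L g G"
  shows "bounded_gradient (\<bar>c\<bar> * L) (\<lambda>x. g (c *\<^sub>R x + z)) (\<lambda>x. c *\<^sub>R G (c *\<^sub>R x + z))"
  unfolding bounded_gradient_def gderiv_def
proof (intro conjI allI)
  note D = bounded_gradientD[OF assms]
  show "((\<lambda>x. g (c *\<^sub>R x + z)) has_derivative (\<lambda>h. h \<bullet> (c *\<^sub>R G (c *\<^sub>R x + z)))) (at x)" for x
    by (rule has_derivative_eq_rhs, rule has_derivative_compose[OF _ D(1)])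
      (auto intro!: derivative_eq_intros)
  show "continuous_on UNIV (\<lambda>x. c *\<^sub>R G (c *\<^sub>R x + z))"
    by (intro continuous_intros continuous_on_compose2[OF D(2)]) auto
  show "norm (c *\<^sub>R G (c *\<^sub>R x + z)) \<le> \<bar>c\<bar> * L" for x
    by (simp add: D(3) mult_left_mono)
qed

lemma bounded_gradient_curve:
  assumes "bounded_gradient L g G" and "(y has_vector_derivative y') (at t)"
  shows "((\<lambda>t. g (y t)) has_real_derivative y' \<bullet> G (y t)) (at t)"
  unfolding has_field_derivative_def
  by (rule has_derivative_eq_rhs,
      rule has_derivative_compose[OF assms(2)[unfolded has_vector_derivative_def] bounded_gradientD(1)[OF assms(1)]])
    (auto simp: fun_eq_iff)

lemma bounded_gradient_inner: "bounded_gradient (norm v) (\<lambda>z. z \<bullet> v) (\<lambda>_. v)"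
  unfolding bounded_gradient_def gderiv_def by (auto intro!: derivative_eq_intros)

section \<open>Gaussian integration by parts\<close>

lemma integrable_std_normal_linear_growth:
  assumes "h \<in> borel_measurable borel" and "\<And>x. \<bar>h x\<bar> \<le> C + L * \<bar>x\<bar>"
  shows "integrable lborel (\<lambda>x. std_normal_density x * (x * h x))"
proof (rule Bochner_Integration.integrable_bound)
  show "integrable lborel (\<lambda>x. C * (std_normal_density x * \<bar>x\<bar> ^ 1) + L * (std_normal_density x * x ^ 2))"
    by (intro Bochner_Integration.integrable_add integrable_mult_right
        integrable_std_normal_moment_abs integrable_std_normal_moment)
  show "AE x in lborel. norm (std_normal_density x * (x * h x)) \<le>
      norm (C * (std_normal_density x * \<bar>x\<bar> ^ 1) + L * (std_normal_density x * x ^ 2))"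
  proof (intro AE_I2)
    fix x :: real
    have "\<bar>x * h x\<bar> \<le> \<bar>x\<bar> * (C + L * \<bar>x\<bar>)"
      using assms(2)[of x] by (simp add: abs_mult mult_left_mono)
    also have "\<dots> = C * \<bar>x\<bar> + L * x\<^sup>2"
      by (simp add: algebra_simps power2_eq_square flip: abs_mult)
    finally have "std_normal_density x * \<bar>x * h x\<bar> \<le> std_normal_density x * (C * \<bar>x\<bar> + L * x\<^sup>2)"
      by (intro mult_left_mono) auto
    then show "norm (std_normal_density x * (x * h x)) \<le>
        norm (C * (std_normal_density x * \<bar>x\<bar> ^ 1) + L * (std_normal_density x * x ^ 2))"
      by (simp add: abs_mult algebra_simps)
  qed
qed (use assms(1) in measurable)

text \<open>
  The density \<open>\<phi>\<close> satisfies \<open>\<phi>' x = - x \<phi> x\<close>, so \<open>\<phi> h' - x \<phi> h\<close> is the derivative of \<open>\<phi> h\<close>. As \<open>h\<close> grows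
  at most linearly, \<open>\<phi> h\<close> vanishes at both ends of the line, and the integral of that derivative is \<open>0\<close>.
\<close>

lemma std_normal_integration_by_parts:
  fixes h h' :: "real \<Rightarrow> real"
  assumes der: "\<And>x. (h has_real_derivative h' x) (at x)"
    and cont: "continuous_on UNIV h'" and bound: "\<And>x. \<bar>h' x\<bar> \<le> L"
  shows "(\<integral>x. std_normal_density x * (x * h x) \<partial>lborel) = (\<integral>x. std_normal_density x * h' x \<partial>lborel)"
proof -
  have growth: "\<bar>h x\<bar> \<le> \<bar>h 0\<bar> + L * \<bar>x\<bar>" for x
  proof -
    have "norm (h x - h 0) \<le> L * norm (x - 0)"
      by (rule field_differentiable_bound[where S=UNIV and f'=h']) (use der bound in auto)
    then show ?thesis by simp
  qed
  have conth: "continuous_on UNIV h"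
    using der by (intro continuous_at_imp_continuous_on ballI DERIV_isCont) auto
  have [measurable]: "h \<in> borel_measurable borel" "h' \<in> borel_measurable borel"
    using cont conth by (auto intro: borel_measurable_continuous_onI)
  have int1: "integrable lborel (\<lambda>x. std_normal_density x * (x * h x))"
    by (rule integrable_std_normal_linear_growth[OF _ growth]) simp
  have int2: "integrable lborel (\<lambda>x. std_normal_density x * h' x)"
  proof (rule Bochner_Integration.integrable_bound)
    show "integrable lborel (\<lambda>x. L * (std_normal_density x * x ^ 0))"
      by (intro integrable_mult_right integrable_std_normal_moment)
    show "AE x in lborel. norm (std_normal_density x * h' x) \<le> norm (L * (std_normal_density x * x ^ 0))"
      using bound order_trans[OF abs_ge_zero bound[of 0]]
      by (auto simp: abs_mult mult.commute intro!: AE_I2 mult_right_mono)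
  qed measurable
  have int: "integrable lborel (\<lambda>x. std_normal_density x * h' x - std_normal_density x * (x * h x))"
    using int1 int2 by simp
  have dens: "(std_normal_density has_real_derivative - (std_normal_density x * x)) (at x)" for x
    unfolding std_normal_density_def by (auto intro!: derivative_eq_intros simp: field_simps)
  have decay: "((\<lambda>x. std_normal_density x * h x) \<longlongrightarrow> 0) F"
    if "((\<lambda>x. std_normal_density x * (\<bar>h 0\<bar> + L * \<bar>x\<bar>)) \<longlongrightarrow> 0) F" for F
  proof (rule tendsto_0_le[OF that, of _ 1], intro always_eventually allI)
    fix x
    show "norm (std_normal_density x * h x) \<le> norm (std_normal_density x * (\<bar>h 0\<bar> + L * \<bar>x\<bar>)) * 1"
      using growth[of x] by (auto simp: abs_mult intro!: mult_left_mono)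
  qed
  have "(LBINT x=-\<infinity>..\<infinity>. std_normal_density x * h' x - std_normal_density x * (x * h x)) = 0 - 0"
  proof (rule interval_integral_FTC_integrable[where F="\<lambda>x. std_normal_density x * h x"])
    show "((\<lambda>x. std_normal_density x * h x) has_vector_derivative
        std_normal_density x * h' x - std_normal_density x * (x * h x)) (at x)" for x
      unfolding has_real_derivative_iff_has_vector_derivative[symmetric]
      by (auto intro!: derivative_eq_intros dens der simp: algebra_simps)
    show "isCont (\<lambda>x. std_normal_density x * h' x - std_normal_density x * (x * h x)) x" for x
      using cont conth dens[THEN DERIV_isCont]
      by (auto intro!: continuous_intros simp: continuous_on_eq_continuous_at)
    show "set_integrable lborel (einterval (-\<infinity>) \<infinity>)
        (\<lambda>x. std_normal_density x * h' x - std_normal_density x * (x * h x))"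
      using int by (simp add: set_integrable_def einterval_eq)
    show "(((\<lambda>x. std_normal_density x * h x) \<circ> real_of_ereal) \<longlongrightarrow> 0) (at_right (- \<infinity>))"
      unfolding ereal_tendsto_simps
      by (rule decay) (unfold std_normal_density_def, real_asymp)
    show "(((\<lambda>x. std_normal_density x * h x) \<circ> real_of_ereal) \<longlongrightarrow> 0) (at_left \<infinity>)"
      unfolding ereal_tendsto_simps
      by (rule decay) (unfold std_normal_density_def, real_asymp)
  qed simp
  then have "(\<integral>x. std_normal_density x * h' x - std_normal_density x * (x * h x) \<partial>lborel) = 0"
    by (simp add: interval_lebesgue_integral_def set_lebesgue_integral_def einterval_eq)
  then show ?thesis using int1 int2 by simp
qed

lemma integrable_norm_of_square:
  fixes Z :: "'a \<Rightarrow> 'c::euclidean_space"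
  assumes "finite_measure N" and [measurable]: "Z \<in> borel_measurable N"
    and sq: "integrable N (\<lambda>\<omega>. (norm (Z \<omega>))\<^sup>2)"
  shows "integrable N (\<lambda>\<omega>. norm (Z \<omega>))"
proof -
  interpret finite_measure N by fact
  show ?thesis
  proof (rule Bochner_Integration.integrable_bound)
    show "integrable N (\<lambda>\<omega>. 1 + (norm (Z \<omega>))\<^sup>2)" using sq by simp
    have "t \<le> 1 + t\<^sup>2" for t :: real
      using zero_le_power2[of "t - 1 / 2"] by (simp add: power2_eq_square algebra_simps)
    then show "AE \<omega> in N. norm (norm (Z \<omega>)) \<le> norm (1 + (norm (Z \<omega>))\<^sup>2)" by simp
  qed measurable
qed

lemma integrable_inner_mult_bounded_gradient:
  fixes Z :: "'a \<Rightarrow> 'c::euclidean_space"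
  assumes "finite_measure N" and [measurable]: "Z \<in> borel_measurable N"
    and sq: "integrable N (\<lambda>\<omega>. (norm (Z \<omega>))\<^sup>2)"
    and g: "bounded_gradient L g G"
  shows "integrable N (\<lambda>\<omega>. (Z \<omega> \<bullet> v) * g (Z \<omega>))"
proof -
  interpret finite_measure N by fact
  have [measurable]: "g \<in> borel_measurable borel" using bounded_gradient_measurable[OF g] by simp
  show ?thesis
  proof (rule Bochner_Integration.integrable_bound)
    show "integrable N (\<lambda>\<omega>. norm v * (\<bar>g 0\<bar> * norm (Z \<omega>) + L * (norm (Z \<omega>))\<^sup>2))"
      using sq integrable_norm_of_square[OF assms(1-3)] by simp
    show "AE \<omega> in N. norm ((Z \<omega> \<bullet> v) * g (Z \<omega>))
        \<le> norm (norm v * (\<bar>g 0\<bar> * norm (Z \<omega>) + L * (norm (Z \<omega>))\<^sup>2))"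
    proof (intro AE_I2)
      fix \<omega>
      have "\<bar>Z \<omega> \<bullet> v\<bar> * \<bar>g (Z \<omega>)\<bar> \<le> (norm (Z \<omega>) * norm v) * (\<bar>g 0\<bar> + L * norm (Z \<omega>))"
        by (intro mult_mono Cauchy_Schwarz_ineq2 bounded_gradient_growth[OF g]) auto
      also have "\<dots> = norm v * (\<bar>g 0\<bar> * norm (Z \<omega>) + L * (norm (Z \<omega>))\<^sup>2)"
        by (simp add: algebra_simps power2_eq_square)
      finally show "norm ((Z \<omega> \<bullet> v) * g (Z \<omega>))
        \<le> norm (norm v * (\<bar>g 0\<bar> * norm (Z \<omega>) + L * (norm (Z \<omega>))\<^sup>2))"
        unfolding real_norm_def abs_mult[of "Z \<omega> \<bullet> v"] by linarith
    qed
  qed measurable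
qed

lemma std_normal_vector_measurable:
  fixes Z :: "'b \<Rightarrow> real^'k"
  assumes "std_normal_vector N Z"
  shows "Z \<in> borel_measurable N"
proof -
  have "(\<lambda>\<omega>. Z \<omega> $ j) \<in> borel_measurable N" for j
    using assms distributed_measurable[of N lborel "\<lambda>\<omega>. Z \<omega> $ j"]
    unfolding std_normal_vector_def by fastforce
  then show ?thesis
    by (subst borel_measurable_euclidean_space) (auto simp: Basis_vec_def inner_axis)
qed

lemma std_normal_vector_square_integrable:
  fixes Z :: "'b \<Rightarrow> real^'k"
  assumes "std_normal_vector N Z"
  shows "integrable N (\<lambda>\<omega>. (norm (Z \<omega>))\<^sup>2)"
proof -
  have "integrable N (\<lambda>\<omega>. (Z \<omega> $ j)\<^sup>2)" for j
    using assms integrable_std_normal_moment[of 2]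
    unfolding std_normal_vector_def
    by (subst distributed_integrable[symmetric, of N lborel "\<lambda>\<omega>. Z \<omega> $ j" std_normal_density]) auto
  then show ?thesis
    by (simp add: power2_norm_eq_inner inner_vec_def flip: power2_eq_square)
qed

lemma std_normal_vector_law:
  fixes Z :: "'b \<Rightarrow> real^'k"
  assumes "prob_space N" and Z: "std_normal_vector N Z"
  shows "distr N (Pi\<^sub>M UNIV (\<lambda>_. borel)) (\<lambda>\<omega> j. Z \<omega> $ j) =
    Pi\<^sub>M UNIV (\<lambda>_. density lborel std_normal_density)"
proof -
  interpret prob_space N by fact
  have [measurable]: "(\<lambda>\<omega>. Z \<omega> $ j) \<in> borel_measurable N" for j
    using std_normal_vector_measurable[OF Z] by (rule measurable_compose) simp
  have "distr N borel (\<lambda>\<omega>. Z \<omega> $ j) = distr N lborel (\<lambda>\<omega>. Z \<omega> $ j)" for j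
    by (rule distr_cong) auto
  also have "\<dots> j = density lborel std_normal_density" for j
    using Z distributed_distr_eq_density unfolding std_normal_vector_def by blast
  finally have "distr N borel (\<lambda>\<omega>. Z \<omega> $ j) = density lborel std_normal_density" for j .
  moreover have "distr N (Pi\<^sub>M UNIV (\<lambda>_. borel)) (\<lambda>\<omega>. \<lambda>j\<in>UNIV. Z \<omega> $ j) =
      Pi\<^sub>M UNIV (\<lambda>j. distr N borel (\<lambda>\<omega>. Z \<omega> $ j))"
    using Z unfolding std_normal_vector_def
    by (intro indep_vars_iff_distr_eq_PiM[THEN iffD1]) auto
  ultimately show ?thesis by (simp add: restrict_UNIV)
qed

text \<open>
  Independence turns the law of the coordinates into a product measure. With all coordinates but the
  \<open>j\<close>-th fixed, the formula is the one on the line; Fubini's theorem averages it over the others.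
\<close>

lemma std_normal_vector_integration_by_parts_coordinate:
  fixes Z :: "'b \<Rightarrow> real^'k"
  assumes N: "prob_space N" and Z: "std_normal_vector N Z" and g: "bounded_gradient L g G"
  shows "(\<integral>\<omega>. Z \<omega> $ j * g (Z \<omega>) \<partial>N) = (\<integral>\<omega>. G (Z \<omega>) $ j \<partial>N)"
proof -
  interpret prob_space N by fact
  let ?\<gamma> = "density lborel std_normal_density"
  have [measurable]: "g \<in> borel_measurable borel" "G \<in> borel_measurable borel"
    using bounded_gradient_measurable[OF g] by auto
  have [measurable]: "Z \<in> borel_measurable N" by (rule std_normal_vector_measurable[OF Z])
  have [measurable]: "(\<lambda>x :: real^'k. x $ i) \<in> borel_measurable borel" for i
    by (intro borel_measurable_continuous_onI continuous_intros)
  interpret product_sigma_finite "\<lambda>_::'k. ?\<gamma>"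
    unfolding product_sigma_finite_def
    by (intro allI prob_space_imp_sigma_finite prob_space_normal_density) simp
  let ?vec = "\<lambda>y :: 'k \<Rightarrow> real. \<chi> i. y i"
  have [measurable]: "?vec \<in> borel_measurable (Pi\<^sub>M UNIV (\<lambda>_. borel))"
    by (subst borel_measurable_euclidean_space) (auto simp: Basis_vec_def inner_axis)
  have [measurable]: "(\<lambda>\<omega> j. Z \<omega> $ j) \<in> N \<rightarrow>\<^sub>M Pi\<^sub>M UNIV (\<lambda>_. borel)"
  proof (rule measurable_PiM_single')
    show "(\<lambda>\<omega>. Z \<omega> $ i) \<in> borel_measurable N" for i by measurable
  qed simp
  have fubini: "(\<integral>\<omega>. \<Phi> (\<lambda>i. Z \<omega> $ i) \<partial>N) =
      (\<integral>x. (\<integral>t. std_normal_density t * \<Phi> (x(j := t)) \<partial>lborel) \<partial>Pi\<^sub>M (UNIV - {j}) (\<lambda>_. ?\<gamma>))"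
    if [measurable]: "\<Phi> \<in> borel_measurable (Pi\<^sub>M UNIV (\<lambda>_. borel))"
      and int: "integrable N (\<lambda>\<omega>. \<Phi> (\<lambda>i. Z \<omega> $ i))"
    for \<Phi> :: "('k \<Rightarrow> real) \<Rightarrow> real"
  proof -
    have ins: "insert j (UNIV - {j}) = UNIV" by auto
    have "integrable (Pi\<^sub>M UNIV (\<lambda>_. ?\<gamma>)) \<Phi>"
      unfolding std_normal_vector_law[OF N Z, symmetric] by (subst integrable_distr_eq) (use int in auto)
    then have "(\<integral>y. \<Phi> y \<partial>Pi\<^sub>M UNIV (\<lambda>_. ?\<gamma>)) =
        (\<integral>x. (\<integral>t. \<Phi> (x(j := t)) \<partial>?\<gamma>) \<partial>Pi\<^sub>M (UNIV - {j}) (\<lambda>_. ?\<gamma>))"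
      using product_integral_insert[of "UNIV - {j}" j \<Phi>] by (simp add: ins)
    also have "\<dots> = (\<integral>x. (\<integral>t. std_normal_density t * \<Phi> (x(j := t)) \<partial>lborel) \<partial>Pi\<^sub>M (UNIV - {j}) (\<lambda>_. ?\<gamma>))"
    proof (rule Bochner_Integration.integral_cong[OF refl])
      fix x :: "'k \<Rightarrow> real"
      have "(\<lambda>t. x(j := t)) \<in> borel \<rightarrow>\<^sub>M Pi\<^sub>M UNIV (\<lambda>_. borel)"
      proof (rule measurable_PiM_single')
        show "(\<lambda>t. (x(j := t)) i) \<in> borel_measurable borel" for i by (cases "i = j") simp_all
      qed simp
      from measurable_compose[OF this that(1)]
      have [measurable]: "(\<lambda>t. \<Phi> (x(j := t))) \<in> borel_measurable borel" .
      show "(\<integral>t. \<Phi> (x(j := t)) \<partial>?\<gamma>) = (\<integral>t. std_normal_density t * \<Phi> (x(j := t)) \<partial>lborel)"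
        by (subst integral_density) auto
    qed
    finally show ?thesis
      unfolding std_normal_vector_law[OF N Z, symmetric] by (subst (asm) integral_distr) auto
  qed
  have int1: "integrable N (\<lambda>\<omega>. Z \<omega> $ j * g (Z \<omega>))"
    using integrable_inner_mult_bounded_gradient[OF finite_measure_axioms _
        std_normal_vector_square_integrable[OF Z] g, of "axis j 1"]
    by (simp add: inner_axis)
  have int2: "integrable N (\<lambda>\<omega>. G (Z \<omega>) $ j)"
    by (rule integrable_const_bound[where B=L])
      (use order_trans[OF component_le_norm_cart bounded_gradientD(3)[OF g]] in auto)
  have line: "((\<lambda>t. ?vec (x(j := t))) has_vector_derivative axis j 1) (at t)" for x t
  proof -
    have eq: "(\<lambda>t. ?vec (x(j := t))) = (\<lambda>t. ?vec (x(j := 0)) + t *\<^sub>R axis j 1)"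
      by (auto simp: vec_eq_iff axis_def fun_eq_iff)
    show ?thesis unfolding eq by (auto intro!: derivative_eq_intros simp: has_vector_derivative_def)
  qed
  have "(\<integral>\<omega>. Z \<omega> $ j * g (Z \<omega>) \<partial>N) = (\<integral>x. (\<integral>t. std_normal_density t *
      (t * g (?vec (x(j := t)))) \<partial>lborel) \<partial>Pi\<^sub>M (UNIV - {j}) (\<lambda>_. ?\<gamma>))"
    using fubini[of "\<lambda>y. y j * g (?vec y)"] int1 by simp
  also have "\<dots> = (\<integral>x. (\<integral>t. std_normal_density t *
      G (?vec (x(j := t))) $ j \<partial>lborel) \<partial>Pi\<^sub>M (UNIV - {j}) (\<lambda>_. ?\<gamma>))"
  proof (rule Bochner_Integration.integral_cong[OF refl], rule std_normal_integration_by_parts)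
    fix x :: "'k \<Rightarrow> real" and t :: real
    show "((\<lambda>t. g (?vec (x(j := t)))) has_real_derivative G (?vec (x(j := t))) $ j) (at t)"
      using bounded_gradient_curve[OF g line] by (simp add: inner_axis')
    have "continuous_on UNIV (\<lambda>t. ?vec (x(j := t)))"
      using line by (intro continuous_at_imp_continuous_on ballI) (rule has_vector_derivative_continuous)
    then show "continuous_on UNIV (\<lambda>t. G (?vec (x(j := t))) $ j)"
      by (rule continuous_on_component[OF continuous_on_compose2[OF bounded_gradientD(2)[OF g]]]) simp
    show "\<bar>G (?vec (x(j := t))) $ j\<bar> \<le> L"
      using component_le_norm_cart bounded_gradientD(3)[OF g] order_trans by blast
  qed
  also have "\<dots> = (\<integral>\<omega>. G (Z \<omega>) $ j \<partial>N)"
    using fubini[of "\<lambda>y. G (?vec y) $ j"] int2 by simp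
  finally show ?thesis .
qed

lemma std_normal_vector_integration_by_parts:
  fixes Z :: "'b \<Rightarrow> real^'k"
  assumes N: "prob_space N" and Z: "std_normal_vector N Z" and g: "bounded_gradient L g G"
  shows "(\<integral>\<omega>. (Z \<omega> \<bullet> v) * g (Z \<omega>) \<partial>N) = (\<integral>\<omega>. v \<bullet> G (Z \<omega>) \<partial>N)"
proof -
  interpret prob_space N by fact
  have [measurable]: "g \<in> borel_measurable borel" "G \<in> borel_measurable borel"
    using bounded_gradient_measurable[OF g] by auto
  have [measurable]: "Z \<in> borel_measurable N" by (rule std_normal_vector_measurable[OF Z])
  have int1: "integrable N (\<lambda>\<omega>. Z \<omega> $ j * g (Z \<omega>))" for j
    using integrable_inner_mult_bounded_gradient[OF finite_measure_axioms _
        std_normal_vector_square_integrable[OF Z] g, of "axis j 1"]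
    by (simp add: inner_axis)
  have [measurable]: "(\<lambda>x :: real^'k. x $ i) \<in> borel_measurable borel" for i
    by (intro borel_measurable_continuous_onI continuous_intros)
  have int2: "integrable N (\<lambda>\<omega>. G (Z \<omega>) $ j)" for j
    by (rule integrable_const_bound[where B=L])
      (use order_trans[OF component_le_norm_cart bounded_gradientD(3)[OF g]] in auto)
  have "(\<integral>\<omega>. (Z \<omega> \<bullet> v) * g (Z \<omega>) \<partial>N) = (\<Sum>j\<in>UNIV. v $ j * (\<integral>\<omega>. Z \<omega> $ j * g (Z \<omega>) \<partial>N))"
  proof -
    have "(Z \<omega> \<bullet> v) * g (Z \<omega>) = (\<Sum>j\<in>UNIV. v $ j * (Z \<omega> $ j * g (Z \<omega>)))" for \<omega>
      by (simp add: inner_vec_def sum_distrib_left mult_ac)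
    then show ?thesis using int1 by simp
  qed
  also have "\<dots> = (\<Sum>j\<in>UNIV. v $ j * (\<integral>\<omega>. G (Z \<omega>) $ j \<partial>N))"
    by (simp add: std_normal_vector_integration_by_parts_coordinate[OF N Z g])
  also have "\<dots> = (\<integral>\<omega>. v \<bullet> G (Z \<omega>) \<partial>N)"
    using int2 by (simp add: inner_vec_def)
  finally show ?thesis .
qed

section \<open>Smooth approximation of Lipschitz functions\<close>

lemma integrable_lborel_compact_support:
  fixes \<phi> :: "'a::euclidean_space \<Rightarrow> 'b::{banach, second_countable_topology}"
  assumes "continuous_on UNIV \<phi>" and "\<And>v. v \<notin> cball c R \<Longrightarrow> \<phi> v = 0"
  shows "integrable lborel \<phi>"
proof -
  have "integrable lborel (\<lambda>v. indicator (cball c R) v *\<^sub>R \<phi> v)"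
    by (rule borel_integrable_compact) (use assms(1) continuous_on_subset in auto)
  also have "(\<lambda>v. indicator (cball c R) v *\<^sub>R \<phi> v) = \<phi>"
    using assms(2) by (auto simp: fun_eq_iff indicator_def)
  finally show ?thesis .
qed

lemma lborel_integral_translation:
  fixes \<phi> :: "'a::euclidean_space \<Rightarrow> 'b::{banach, second_countable_topology}"
  assumes "\<phi> \<in> borel_measurable borel"
  shows "(\<integral>u. \<phi> u \<partial>lborel) = (\<integral>v. \<phi> (x + v) \<partial>lborel)"
proof -
  have "(\<integral>u. \<phi> u \<partial>distr lborel borel ((+) x)) = (\<integral>v. \<phi> (x + v) \<partial>lborel)"
    using assms by (subst integral_distr) auto
  then show ?thesis by (simp add: lborel_distr_plus)
qed

text \<open>
  Squaring the positive part is the simplest way to make the cut-off continuously differentiable at the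
  unit sphere.
\<close>

definition bump :: "'a::euclidean_space \<Rightarrow> real" where
  "bump v = (max 0 (1 - v \<bullet> v))\<^sup>2"

lemma continuous_on_bump [continuous_intros]:
  "continuous_on S f \<Longrightarrow> continuous_on S (\<lambda>x. bump (f x))"
  unfolding bump_def by (intro continuous_intros)

lemma bump_eq_0: "norm v \<ge> 1 \<Longrightarrow> bump v = 0"
  using power_mono[of 1 "norm v" 2] by (simp add: bump_def dot_square_norm)

lemma bump_nonneg: "bump v \<ge> 0"
  by (simp add: bump_def)

lemma integral_bump_pos: "0 < (\<integral>v. bump (v :: 'a::euclidean_space) \<partial>lborel)"
proof -
  have "0 < (9/16) * measure lborel (ball (0::'a) (1/2))"
    using content_ball_pos[of "1/2" "0::'a"] by simp
  also have "\<dots> = (\<integral>v. (9/16) * indicator (ball (0::'a) (1/2)) v \<partial>lborel)" by simp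
  also have "\<dots> \<le> (\<integral>v. bump (v::'a) \<partial>lborel)"
  proof (rule integral_mono)
    show "integrable lborel (bump :: 'a \<Rightarrow> real)"
      by (rule integrable_lborel_compact_support[of _ 0 1]) (auto intro!: continuous_intros bump_eq_0)
    show "(9/16) * indicator (ball 0 (1/2)) v \<le> bump v" for v :: 'a
    proof (cases "norm v < 1/2")
      case True
      then have "(norm v)\<^sup>2 \<le> (1/2)\<^sup>2" by (intro power_mono) auto
      then have "v \<bullet> v \<le> 1/4" by (simp add: dot_square_norm power2_eq_square)
      then have "3/4 \<le> max 0 (1 - v \<bullet> v)" by simp
      then have "(3/4)\<^sup>2 \<le> bump v" unfolding bump_def by (rule power_mono) simp
      then show ?thesis using True by (simp add: power2_eq_square)
    qed (simp add: bump_nonneg)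
    show "integrable lborel (\<lambda>v. (9/16) * indicator (ball (0::'a) (1/2)) v :: real)"
      by (intro integrable_mult_right integrable_real_indicator) (use emeasure_bounded_finite[of "ball (0::'a) (1/2)"] in \<open>auto simp: less_top\<close>)
  qed
  finally show ?thesis .
qed

text \<open>
  The second-order error of the translated bump is uniform in \<open>v\<close> and supported in a fixed ball.
  Differentiability of a convolution with \<open>bump\<close> follows from this by integration alone, without a
  limit theorem. The positive part squared has first-order Taylor error at most \<open>(s - t)\<^sup>2\<close>, and
  \<open>\<bar>s - t\<bar> \<le> 5 \<bar>h\<bar>\<close> for \<open>\<bar>v\<bar> \<le> 2\<close> and \<open>\<bar>h\<bar> \<le> 1\<close>; this gives \<open>25\<close>, and the quadratic part of \<open>s - t\<close> adds \<open>2\<close>.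
  For \<open>\<bar>v\<bar> > 2\<close> both bumps vanish.
\<close>

lemma bump_quadratic_approximation:
  assumes "norm h \<le> 1"
  shows "\<bar>bump (v - h) - bump v - 4 * max 0 (1 - v \<bullet> v) * (v \<bullet> h)\<bar>
    \<le> 27 * (norm h)\<^sup>2 * indicator (cball 0 2) v"
proof (cases "norm v \<le> 2")
  case True
  define s t where "s = 1 - (v - h) \<bullet> (v - h)" and "t = 1 - v \<bullet> v"
  have st: "s - t = 2 * (v \<bullet> h) - (norm h)\<^sup>2"
    by (simp add: s_def t_def inner_diff inner_commute flip: dot_square_norm)
  have square: "\<bar>(max 0 s)\<^sup>2 - (max 0 t)\<^sup>2 - 2 * max 0 t * (s - t)\<bar> \<le> (s - t)\<^sup>2"
  proof (cases "0 \<le> s"; cases "0 \<le> t")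
    assume st: "0 \<le> s" "0 \<le> t"
    have "s\<^sup>2 - t\<^sup>2 - 2 * t * (s - t) = (s - t)\<^sup>2" by algebra
    then show ?thesis using st by simp
  next
    assume st: "0 \<le> s" "\<not> 0 \<le> t"
    then have "s\<^sup>2 \<le> (s - t)\<^sup>2" by (intro power_mono) auto
    then show ?thesis using st by simp
  next
    assume st: "\<not> 0 \<le> s" "0 \<le> t"
    then have "s * t \<le> 0" by (simp add: mult_nonpos_nonneg)
    moreover have "- t\<^sup>2 - 2 * t * (s - t) = t\<^sup>2 - 2 * (s * t)" "(s - t)\<^sup>2 = s\<^sup>2 + (t\<^sup>2 - 2 * (s * t))"
      by algebra+
    moreover have "0 \<le> s\<^sup>2" "0 \<le> t\<^sup>2" by simp_all
    ultimately have "\<bar>- t\<^sup>2 - 2 * t * (s - t)\<bar> \<le> (s - t)\<^sup>2" by linarith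
    then show ?thesis using st by simp
  qed simp
  have "\<bar>v \<bullet> h\<bar> \<le> 2 * norm h"
    using Cauchy_Schwarz_ineq2[of v h] mult_right_mono[OF True, of "norm h"] by simp
  moreover have "(norm h)\<^sup>2 \<le> norm h"
    using assms mult_left_mono[of "norm h" 1 "norm h"] by (simp add: power2_eq_square)
  ultimately have "\<bar>s - t\<bar> \<le> 5 * norm h"
    unfolding st using zero_le_power2[of "norm h"] by linarith
  then have "(s - t)\<^sup>2 \<le> 25 * (norm h)\<^sup>2"
    using power_mono[of "\<bar>s - t\<bar>" "5 * norm h" 2] by (simp add: power_mult_distrib)
  moreover have "max 0 t * (norm h)\<^sup>2 \<le> 1 * (norm h)\<^sup>2"
    by (intro mult_right_mono) (auto simp: t_def)
  moreover have "0 \<le> max 0 t * (norm h)\<^sup>2" by simp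
  moreover have "bump (v - h) - bump v - 4 * max 0 (1 - v \<bullet> v) * (v \<bullet> h) =
      ((max 0 s)\<^sup>2 - (max 0 t)\<^sup>2 - 2 * max 0 t * (s - t)) - 2 * (max 0 t * (norm h)\<^sup>2)"
    unfolding st bump_def s_def[symmetric] t_def[symmetric] by (simp add: algebra_simps)
  ultimately have "\<bar>bump (v - h) - bump v - 4 * max 0 (1 - v \<bullet> v) * (v \<bullet> h)\<bar> \<le> 27 * (norm h)\<^sup>2"
    using square by linarith
  then show ?thesis using True by simp
next
  case False
  have "norm (v - h) \<ge> 1" using False assms norm_triangle_ineq2[of v h] by linarith
  moreover have "1 - v \<bullet> v \<le> 0" using False power_mono[of 1 "norm v" 2] by (simp add: dot_square_norm)
  ultimately show ?thesis using False by (simp add: bump_eq_0)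
qed

lemma has_derivative_quadratic_error:
  fixes g :: "'a::euclidean_space \<Rightarrow> real"
  assumes "bounded_linear D" and "\<And>h. norm h \<le> 1 \<Longrightarrow> \<bar>g (x + h) - g x - D h\<bar> \<le> K * (norm h)\<^sup>2"
  shows "(g has_derivative D) (at x)"
  unfolding has_derivative_at
proof (intro conjI assms(1))
  show "(\<lambda>h. norm (g (x + h) - g x - D h) / norm h) \<midarrow>0\<rightarrow> 0"
  proof (rule Lim_null_comparison)
    show "((\<lambda>h::'a. K * norm h) \<longlongrightarrow> 0) (at 0)"
      by (auto intro!: tendsto_eq_intros)
    have "\<forall>\<^sub>F h in at (0::'a). h \<in> ball 0 1 - {0}"
      by (intro eventually_at_in_open) auto
    then show "\<forall>\<^sub>F h in at 0. norm (norm (g (x + h) - g x - D h) / norm h) \<le> K * norm h"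
    proof eventually_elim
      case (elim h)
      then show ?case using assms(2)[of h] by (simp add: divide_simps power2_eq_square mult_ac)
    qed
  qed
qed

text \<open>
  Moving from \<open>x\<close> in the direction \<open>G\<close> itself, \<open>g\<close> changes at the rate \<open>\<bar>G\<bar>\<^sup>2\<close> while the Lipschitz bound allows
  only \<open>L \<bar>G\<bar>\<close>.
\<close>

lemma gradient_bound_of_Lipschitz:
  fixes g :: "'a::euclidean_space \<Rightarrow> real"
  assumes der: "(g has_derivative (\<lambda>h. h \<bullet> G)) (at x)"
    and lip: "\<And>y. \<bar>g y - g x\<bar> \<le> L * norm (y - x)"
  shows "norm G \<le> L"
proof (cases "G = 0")
  case True
  have "0 \<le> L * norm (SOME b. b \<in> (Basis :: 'a set))"
    using order_trans[OF abs_ge_zero lip[of "x + (SOME b. b \<in> Basis)"]] by simp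
  then show ?thesis using True by (simp add: SOME_Basis)
next
  case False
  have "((\<lambda>t. g (x + t *\<^sub>R G)) has_derivative (\<lambda>t. (t *\<^sub>R G) \<bullet> G)) (at 0)"
    by (rule has_derivative_compose[where f="\<lambda>t. x + t *\<^sub>R G"]) (use der in \<open>auto intro!: derivative_eq_intros\<close>)
  then have "((\<lambda>t. g (x + t *\<^sub>R G)) has_real_derivative G \<bullet> G) (at 0)"
    unfolding has_field_derivative_def by (simp add: mult.commute[of _ "G \<bullet> G"] fun_eq_iff)
  then have "((\<lambda>t. (g (x + t *\<^sub>R G) - g x) / t) \<longlongrightarrow> G \<bullet> G) (at 0)"
    by (simp add: DERIV_def)
  moreover have "(g (x + t *\<^sub>R G) - g x) / t \<le> L * norm G" for t
  proof (cases "t = 0")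
    case False
    have "\<bar>(g (x + t *\<^sub>R G) - g x) / t\<bar> \<le> L * norm G"
      using lip[of "x + t *\<^sub>R G"] False by (simp add: divide_simps mult_ac)
    then show ?thesis by linarith
  qed (use order_trans[OF abs_ge_zero lip[of "x + G"]] in simp)
  ultimately have "G \<bullet> G \<le> L * norm G"
    by (intro tendsto_upperbound) auto
  then show ?thesis using False by (simp add: dot_square_norm power2_eq_square)
qed

text \<open>
  Convolution of \<open>f\<close> with the normalised bump. Written as an average of \<open>f (x + v)\<close> over \<open>v\<close>, it inherits
  the Lipschitz constant and moves \<open>f\<close> by at most the radius \<open>1\<close> of the bump; written as an integral of
  \<open>f u\<close> against \<open>bump (u - x)\<close>, it can be differentiated because \<open>x\<close> occurs only in the bump.
\<close>

lemma smooth_approximation_unit: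
  fixes f :: "'a::euclidean_space \<Rightarrow> real"
  assumes "1-lipschitz_on UNIV f"
  obtains g G where "bounded_gradient 1 g G" and "\<And>x. \<bar>g x - f x\<bar> \<le> 1"
proof -
  have lip: "\<bar>f x - f y\<bar> \<le> norm (x - y)" for x y
    using lipschitz_onD[OF assms, of x y] by (simp add: dist_norm)
  have cont: "continuous_on UNIV f" using assms lipschitz_on_continuous_on by blast
  note cont' [continuous_intros] = continuous_on_compose2[OF cont _ subset_UNIV]
  define c where "c = (\<integral>v. bump (v :: 'a) \<partial>lborel)"
  have c: "c > 0" unfolding c_def by (rule integral_bump_pos)
  define k where "k v = (4 * max 0 (1 - v \<bullet> v)) *\<^sub>R v" for v :: 'a
  have contk [continuous_intros]: "continuous_on S (\<lambda>x. k (f x))" if "continuous_on S f" for S and f :: "'b::topological_space \<Rightarrow> 'a"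
    unfolding k_def by (intro continuous_intros that)
  have k0: "k v = 0" if "norm v \<ge> 1" for v
    using power_mono[OF that, of 2] by (simp add: k_def dot_square_norm)
  define g where "g x = (\<integral>u. f u * bump (u - x) \<partial>lborel) / c" for x
  define G where "G x = (1 / c) *\<^sub>R (\<integral>u. f u *\<^sub>R k (u - x) \<partial>lborel)" for x
  have outside: "norm (u - x) \<ge> 1" if "u \<notin> cball x 1" for u x :: 'a
    using that by (simp add: dist_norm norm_minus_commute)
  have int_g: "integrable lborel (\<lambda>u. f u * bump (u - x))" for x
    by (rule integrable_lborel_compact_support[of _ x 1])
      (auto intro!: continuous_intros bump_eq_0 outside)
  have int_G: "integrable lborel (\<lambda>u. f u *\<^sub>R k (u - x))" for x
    by (rule integrable_lborel_compact_support[of _ x 1])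
      (auto intro!: continuous_intros k0 outside)
  have int_g': "integrable lborel (\<lambda>v. f (x + v) * bump v)" for x
    by (rule integrable_lborel_compact_support[of _ 0 1]) (auto intro!: continuous_intros bump_eq_0)
  have int_G': "integrable lborel (\<lambda>v. f (x + v) *\<^sub>R k v)" for x
    by (rule integrable_lborel_compact_support[of _ 0 1]) (auto intro!: continuous_intros k0)
  have int_bump: "integrable lborel (bump :: 'a \<Rightarrow> real)"
    by (rule integrable_lborel_compact_support[of _ 0 1]) (auto intro!: continuous_intros bump_eq_0)
  have int_k: "integrable lborel (\<lambda>v. norm (k v))"
    by (rule integrable_lborel_compact_support[of _ 0 1]) (auto intro!: continuous_intros k0)
  have g_eq: "g x = (\<integral>v. f (x + v) * bump v \<partial>lborel) / c" for x
    unfolding g_def by (subst lborel_integral_translation[of _ x])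
      (auto intro!: borel_measurable_continuous_onI continuous_intros)
  have G_eq: "G x = (1 / c) *\<^sub>R (\<integral>v. f (x + v) *\<^sub>R k v \<partial>lborel)" for x
    unfolding G_def by (subst lborel_integral_translation[of _ x])
      (auto intro!: borel_measurable_continuous_onI continuous_intros)
  have g_lip: "\<bar>g y - g x\<bar> \<le> 1 * norm (y - x)" for x y
  proof -
    have "norm (\<integral>v. f (y + v) * bump v - f (x + v) * bump v \<partial>lborel) \<le> (\<integral>v. norm (y - x) * bump (v :: 'a) \<partial>lborel)"
    proof (rule lebesgue_integral_norm_bound)
      show "norm (f (y + v) * bump v - f (x + v) * bump v) \<le> norm (y - x) * bump v" for v
        using mult_right_mono[OF lip[of "y + v" "x + v"] bump_nonneg[of v]] bump_nonneg[of v]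
        by (simp add: abs_mult flip: left_diff_distrib)
    qed (use int_g' int_bump in auto)
    then show ?thesis
      using c int_g' by (simp add: g_eq c_def[symmetric] divide_simps flip: diff_divide_distrib)
  qed
  have close: "\<bar>g x - f x\<bar> \<le> 1" for x
  proof -
    have "norm (\<integral>v. f (x + v) * bump v - f x * bump v \<partial>lborel) \<le> (\<integral>v. bump (v :: 'a) \<partial>lborel)"
    proof (rule lebesgue_integral_norm_bound)
      fix v :: 'a
      show "norm (f (x + v) * bump v - f x * bump v) \<le> bump v"
      proof (cases "norm v \<le> 1")
        case True
        then have "\<bar>f (x + v) - f x\<bar> * bump v \<le> 1 * bump v"
          using lip[of "x + v" x] by (intro mult_right_mono bump_nonneg) simp
        then show ?thesis using bump_nonneg[of v] by (simp add: abs_mult flip: left_diff_distrib)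
      qed (simp add: bump_eq_0)
    qed (use int_g' int_bump in auto)
    moreover have "(\<integral>v. f (x + v) * bump v - f x * bump v \<partial>lborel) = c * (g x - f x)"
      using c int_g' int_bump by (simp add: g_eq c_def[symmetric] right_diff_distrib)
    ultimately show ?thesis
      using c by (simp add: c_def[symmetric] abs_mult)
  qed
  have G_cont: "continuous_on UNIV G"
  proof (rule lipschitz_on_continuous_on, rule lipschitz_onI)
    fix x y :: 'a
    have "norm (\<integral>v. f (x + v) *\<^sub>R k v - f (y + v) *\<^sub>R k v \<partial>lborel) \<le> (\<integral>v. norm (x - y) * norm (k v) \<partial>lborel)"
    proof (rule lebesgue_integral_norm_bound)
      show "norm (f (x + v) *\<^sub>R k v - f (y + v) *\<^sub>R k v) \<le> norm (x - y) * norm (k v)" for v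
        using mult_right_mono[OF lip[of "x + v" "y + v"], of "norm (k v)"] by (simp flip: scaleR_left_diff_distrib)
    qed (use int_G' int_k in auto)
    then show "dist (G x) (G y) \<le> (\<integral>v. norm (k v) \<partial>lborel) / c * dist x y"
      using c int_G' by (simp add: G_eq dist_norm divide_simps mult_ac flip: scaleR_right_diff_distrib)
  qed (use c in simp)
  have der: "(g has_derivative (\<lambda>h. h \<bullet> G x)) (at x)" for x
  proof (rule has_derivative_quadratic_error)
    let ?I = "\<integral>u. \<bar>f u\<bar> * indicator (cball x 2) u \<partial>lborel"
    have int_I: "integrable lborel (\<lambda>u. \<bar>f u\<bar> * indicator (cball x 2) u)"
      using borel_integrable_compact[of "cball x 2" "\<lambda>u. \<bar>f u\<bar>"]
      by (auto simp: mult.commute intro!: continuous_intros continuous_on_subset[OF cont])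
    fix h :: 'a assume h: "norm h \<le> 1"
    have inner: "h \<bullet> (\<integral>u. f u *\<^sub>R k (u - x) \<partial>lborel) = (\<integral>u. f u * (k (u - x) \<bullet> h) \<partial>lborel)"
      using integral_inner_right[of h lborel "\<lambda>u. f u *\<^sub>R k (u - x)"] int_G[of x] by (simp add: inner_commute)
    have int_in: "integrable lborel (\<lambda>u. f u * (k (u - x) \<bullet> h))"
      using integrable_inner_right[of h lborel "\<lambda>u. f u *\<^sub>R k (u - x)"] int_G[of x] by (simp add: inner_commute)
    have "norm (\<integral>u. f u * bump (u - (x + h)) - f u * bump (u - x) - f u * (k (u - x) \<bullet> h) \<partial>lborel)
        \<le> (\<integral>u. (27 * (norm h)\<^sup>2) * (\<bar>f u\<bar> * indicator (cball x 2) u) \<partial>lborel)"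
    proof (rule lebesgue_integral_norm_bound)
      fix u
      have "\<bar>f u\<bar> * \<bar>bump (u - x - h) - bump (u - x) - k (u - x) \<bullet> h\<bar>
          \<le> \<bar>f u\<bar> * (27 * (norm h)\<^sup>2 * indicator (cball 0 2) (u - x))"
        using bump_quadratic_approximation[OF h, of "u - x"]
        by (intro mult_left_mono) (auto simp: k_def)
      also have "indicator (cball 0 2) (u - x) = (indicator (cball x 2) u :: real)"
        by (simp add: indicator_def dist_norm norm_minus_commute)
      finally show "norm (f u * bump (u - (x + h)) - f u * bump (u - x) - f u * (k (u - x) \<bullet> h))
          \<le> (27 * (norm h)\<^sup>2) * (\<bar>f u\<bar> * indicator (cball x 2) u)"
        by (simp add: mult_ac diff_diff_add flip: right_diff_distrib abs_mult)
    qed (use int_g int_in int_I in auto)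
    also have "\<dots> = (27 * (norm h)\<^sup>2) * ?I" by simp
    finally have "norm (\<integral>u. f u * bump (u - (x + h)) - f u * bump (u - x) - f u * (k (u - x) \<bullet> h) \<partial>lborel)
        \<le> (27 * (norm h)\<^sup>2) * ?I" .
    then show "\<bar>g (x + h) - g x - h \<bullet> G x\<bar> \<le> (27 * ?I / c) * (norm h)\<^sup>2"
      using c int_g int_in
      by (simp add: g_def G_def inner divide_simps mult_ac flip: diff_divide_distrib)
  qed (rule bounded_linear_inner_left)
  have "bounded_gradient 1 g G"
    unfolding bounded_gradient_def gderiv_def
    using der G_cont gradient_bound_of_Lipschitz[OF der g_lip] by blast
  then show thesis using close by (rule that)
qed

text \<open>
  Rescaling: the function \<open>f (\<epsilon> x) / \<epsilon>\<close> is again \<open>1\<close>-Lipschitz, and undoing the scaling multiplies the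
  error \<open>1\<close> of the unit-scale approximation by \<open>\<epsilon>\<close>.
\<close>

lemma smooth_approximation:
  fixes f :: "'a::euclidean_space \<Rightarrow> real"
  assumes f: "1-lipschitz_on UNIV f" and "\<epsilon> > 0"
  obtains g G where "bounded_gradient 1 g G" and "\<And>x. \<bar>g x - f x\<bar> \<le> \<epsilon>"
proof -
  have "1-lipschitz_on UNIV (\<lambda>x. f (\<epsilon> *\<^sub>R x) / \<epsilon>)"
  proof (rule lipschitz_onI)
    fix x y :: 'a
    have "\<bar>f (\<epsilon> *\<^sub>R x) - f (\<epsilon> *\<^sub>R y)\<bar> \<le> \<epsilon> * norm (x - y)"
      using lipschitz_onD[OF f, of "\<epsilon> *\<^sub>R x" "\<epsilon> *\<^sub>R y"] \<open>\<epsilon> > 0\<close>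
      by (simp add: dist_norm flip: scaleR_right_diff_distrib)
    then show "dist (f (\<epsilon> *\<^sub>R x) / \<epsilon>) (f (\<epsilon> *\<^sub>R y) / \<epsilon>) \<le> 1 * dist x y"
      using \<open>\<epsilon> > 0\<close> by (simp add: dist_norm divide_simps mult_ac flip: diff_divide_distrib)
  qed simp
  then obtain g G where g: "bounded_gradient 1 g G" and close: "\<And>x. \<bar>g x - f (\<epsilon> *\<^sub>R x) / \<epsilon>\<bar> \<le> 1"
    by (rule smooth_approximation_unit) blast
  let ?g = "\<lambda>x. \<epsilon> * g ((1 / \<epsilon>) *\<^sub>R x + 0)" and ?G = "\<lambda>x. G ((1 / \<epsilon>) *\<^sub>R x + 0)"
  have "bounded_gradient 1 ?g ?G"
    unfolding bounded_gradient_def gderiv_def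
  proof (intro conjI allI)
    show "(?g has_derivative (\<lambda>h. h \<bullet> ?G x)) (at x)" for x
      using has_derivative_mult_right[OF bounded_gradientD(1)[OF bounded_gradient_affine[OF g, of "1 / \<epsilon>" 0]], of \<epsilon>] \<open>\<epsilon> > 0\<close>
      by simp
  qed (auto intro!: continuous_intros continuous_on_compose2[OF bounded_gradientD(2)[OF g]] bounded_gradientD(3)[OF g])
  moreover have "\<bar>?g x - f x\<bar> \<le> \<epsilon>" for x
  proof -
    have "\<epsilon> * \<bar>g ((1 / \<epsilon>) *\<^sub>R x) - f x / \<epsilon>\<bar> \<le> \<epsilon> * 1"
      using close[of "(1 / \<epsilon>) *\<^sub>R x"] \<open>\<epsilon> > 0\<close> by (intro mult_left_mono) auto
    moreover have "\<epsilon> * \<bar>g ((1 / \<epsilon>) *\<^sub>R x) - f x / \<epsilon>\<bar> = \<bar>\<epsilon> * (g ((1 / \<epsilon>) *\<^sub>R x) - f x / \<epsilon>)\<bar>"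
      using \<open>\<epsilon> > 0\<close> by (simp add: abs_mult)
    ultimately show ?thesis using \<open>\<epsilon> > 0\<close> by (simp add: right_diff_distrib)
  qed
  ultimately show thesis by (rule that)
qed

section \<open>Columns of a Haar-distributed frame\<close>

lemma haar_stiefelD:
  fixes H :: "(real^'d^'k) measure"
  assumes "haar_stiefel H"
  shows "prob_space H" "space H = stiefel" "sets H = sets stiefel_borel"
    "\<phi> \<in> borel_measurable borel \<Longrightarrow> \<phi> \<in> borel_measurable H"
proof -
  show *: "prob_space H" "sets H = sets stiefel_borel"
    using assms by (auto simp: haar_stiefel_def)
  show "space H = stiefel"
    using sets_eq_imp_space_eq[OF *(2)] by (simp add: space_restrict_space)
  show "\<phi> \<in> borel_measurable H" if "\<phi> \<in> borel_measurable borel"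
    using measurable_restrict_space1[OF that, of stiefel] measurable_cong_sets[OF *(2) refl] by blast
qed

lemma haar_stiefel_invariant:
  fixes H :: "(real^'d^'k) measure" and \<phi> :: "real^'d^'k \<Rightarrow> real"
  assumes H: "haar_stiefel H" and U: "orthogonal_transformation U" and \<phi>: "\<phi> \<in> borel_measurable borel"
  shows "(\<integral>\<theta>. \<phi> (\<chi> j. U (\<theta> $ j)) \<partial>H) = (\<integral>\<theta>. \<phi> \<theta> \<partial>H)"
proof -
  let ?T = "\<lambda>\<theta> :: real^'d^'k. \<chi> j. U (\<theta> $ j)"
  have "linear U" using U by (rule orthogonal_transformation_linear)
  then have "continuous_on UNIV ?T"
    by (intro continuous_on_vec_lambda continuous_on_compose2[OF linear_continuous_on[of U UNIV]]
        continuous_intros) (auto simp: linear_conv_bounded_linear)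
  moreover have "?T \<in> stiefel \<rightarrow> stiefel"
    using U by (auto simp: stiefel_def orthogonal_transformation_def)
  ultimately have "?T \<in> stiefel_borel \<rightarrow>\<^sub>M stiefel_borel"
    by (intro measurable_restrict_space3 borel_measurable_continuous_onI)
  then have T: "?T \<in> H \<rightarrow>\<^sub>M H"
    using measurable_cong_sets[OF haar_stiefelD(3)[OF H] haar_stiefelD(3)[OF H]] by blast
  have "(\<integral>\<theta>. \<phi> \<theta> \<partial>H) = (\<integral>\<theta>. \<phi> \<theta> \<partial>distr H H ?T)"
    using H U by (simp add: haar_stiefel_def)
  also have "\<dots> = (\<integral>\<theta>. \<phi> (?T \<theta>) \<partial>H)"
    by (rule integral_distr[OF T haar_stiefelD(4)[OF H \<phi>]])
  finally show ?thesis by simp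
qed

definition plane_rotation :: "'d \<Rightarrow> 'd \<Rightarrow> real \<Rightarrow> real^'d \<Rightarrow> real^'d" where
  "plane_rotation a b t v = (\<chi> i. if i = a then cos t * v $ a - sin t * v $ b
     else if i = b then sin t * v $ a + cos t * v $ b else v $ i)"

lemma orthogonal_plane_rotation:
  fixes a b :: "'d::finite"
  assumes "a \<noteq> b"
  shows "orthogonal_transformation (plane_rotation a b t)"
  unfolding orthogonal_transformation_def
proof (intro conjI allI)
  show "linear (plane_rotation a b t)"
    by (rule linearI) (auto simp: plane_rotation_def vec_eq_iff algebra_simps)
  fix v w :: "real^'d"
  have split: "(\<Sum>i\<in>UNIV. f i) = f a + f b + (\<Sum>i\<in>UNIV - {a, b}. f i)" for f :: "'d \<Rightarrow> real"
  proof -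
    have "(\<Sum>i\<in>UNIV. f i) = (\<Sum>i\<in>{a, b}. f i) + (\<Sum>i\<in>UNIV - {a, b}. f i)"
      by (subst sum.subset_diff[of "{a, b}"]) auto
    then show ?thesis using assms by simp
  qed
  have rest: "(\<Sum>i\<in>UNIV - {a, b}. plane_rotation a b t v $ i * plane_rotation a b t w $ i)
      = (\<Sum>i\<in>UNIV - {a, b}. v $ i * w $ i)"
    by (rule sum.cong) (auto simp: plane_rotation_def)
  have "(cos t * v $ a - sin t * v $ b) * (cos t * w $ a - sin t * w $ b) +
        (sin t * v $ a + cos t * v $ b) * (sin t * w $ a + cos t * w $ b) =
        ((cos t)\<^sup>2 + (sin t)\<^sup>2) * (v $ a * w $ a + v $ b * w $ b)"
    by algebra
  also have "\<dots> = v $ a * w $ a + v $ b * w $ b"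
    by (simp only: sin_cos_squared_add2 mult_1_left)
  finally have "(cos t * v $ a - sin t * v $ b) * (cos t * w $ a - sin t * w $ b) +
        (sin t * v $ a + cos t * v $ b) * (sin t * w $ a + cos t * w $ b) =
        v $ a * w $ a + v $ b * w $ b" .
  then show "plane_rotation a b t v \<bullet> plane_rotation a b t w = v \<bullet> w"
    using assms unfolding inner_vec_def split rest by (simp add: plane_rotation_def)
qed

lemma continuous_on_column [continuous_intros]:
  "continuous_on S f \<Longrightarrow> continuous_on S (\<lambda>x. column b (f x :: real^'d^'k))"
  unfolding column_def by (intro continuous_intros)

lemma norm_projection_le:
  fixes \<theta> :: "real^'d^'k"
  assumes "\<theta> \<in> stiefel"
  shows "norm (\<chi> j. \<theta> $ j \<bullet> y) \<le> CARD('k) * norm y"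
proof -
  have "norm (\<chi> j. \<theta> $ j \<bullet> y) \<le> (\<Sum>j\<in>UNIV. \<bar>\<theta> $ j \<bullet> y\<bar>)"
    using norm_le_l1_cart[of "\<chi> j. \<theta> $ j \<bullet> y"] by (simp only: vec_lambda_beta)
  also have "\<dots> \<le> (\<Sum>j\<in>(UNIV :: 'k set). norm y)"
  proof (rule sum_mono)
    fix j
    have "norm (\<theta> $ j) = 1" using assms by (simp add: stiefel_def norm_eq_1)
    then show "\<bar>\<theta> $ j \<bullet> y\<bar> \<le> norm y" using Cauchy_Schwarz_ineq2[of "\<theta> $ j" y] by simp
  qed
  finally show ?thesis by simp
qed

lemma norm_column_stiefel_le:
  fixes \<theta> :: "real^'d^'k"
  assumes "\<theta> \<in> stiefel"
  shows "norm (column b \<theta>) \<le> CARD('k)"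
proof -
  have "column b \<theta> = (\<chi> j. \<theta> $ j \<bullet> axis b 1)"
    by (simp add: column_def inner_axis vec_eq_iff)
  then show ?thesis using norm_projection_le[OF assms, of "axis b 1"] by simp
qed

text \<open>
  The rows of \<open>\<theta>\<close> are orthonormal, so \<open>\<theta> \<theta>\<^sup>T\<close> is the identity; in terms of columns \<open>w\<^sub>b\<close> this says
  \<open>\<Sum>\<^sub>b w\<^sub>b w\<^sub>b\<^sup>T = I\<close>.
\<close>

lemma sum_columns_stiefel:
  fixes \<theta> :: "real^'d^'k"
  assumes "\<theta> \<in> stiefel"
  shows "(\<Sum>b\<in>UNIV. (z \<bullet> column b \<theta>) * (column b \<theta> \<bullet> v)) = z \<bullet> v"
proof -
  have "(\<Sum>b\<in>UNIV. (z \<bullet> column b \<theta>) * (column b \<theta> \<bullet> v)) =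
      (\<Sum>b\<in>UNIV. \<Sum>i\<in>UNIV. \<Sum>j\<in>UNIV. z $ i * v $ j * (\<theta> $ i $ b * \<theta> $ j $ b))"
    unfolding inner_vec_def column_def sum_product by (simp add: mult_ac)
  also have "\<dots> = (\<Sum>i\<in>UNIV. \<Sum>b\<in>UNIV. \<Sum>j\<in>UNIV. z $ i * v $ j * (\<theta> $ i $ b * \<theta> $ j $ b))"
    by (rule sum.swap)
  also have "\<dots> = (\<Sum>i\<in>UNIV. \<Sum>j\<in>UNIV. \<Sum>b\<in>UNIV. z $ i * v $ j * (\<theta> $ i $ b * \<theta> $ j $ b))"
    by (rule sum.cong[OF refl], rule sum.swap)
  also have "\<dots> = (\<Sum>i\<in>UNIV. \<Sum>j\<in>UNIV. z $ i * v $ j * (\<theta> $ i \<bullet> \<theta> $ j))"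
    by (simp add: inner_vec_def sum_distrib_left)
  also have "\<dots> = (\<Sum>i\<in>UNIV. z $ i * v $ i)"
  proof -
    have orth: "\<theta> $ i \<bullet> \<theta> $ j = (if i = j then 1 else 0)" for i j
      using assms by (simp add: stiefel_def)
    show ?thesis by (simp add: orth if_distrib cong: if_cong)
  qed
  finally show ?thesis by (simp add: inner_vec_def)
qed

text \<open>
  Rotating the plane of the coordinates \<open>a\<close> and \<open>b\<close> mixes the columns \<open>w\<^sub>a\<close> and \<open>w\<^sub>b\<close> and preserves the Haar
  measure. Hence the expectation of \<open>(z \<bullet> w\<^sub>b) g(w\<^sub>a)\<close> is constant along the rotation, and the identity is
  the vanishing of its derivative at angle \<open>0\<close>.
\<close>

lemma stiefel_column_rotation_identity:
  fixes H :: "(real^'d^'k) measure"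
  assumes H: "haar_stiefel H" and g: "bounded_gradient L g G" and ab: "a \<noteq> b"
  shows "(\<integral>\<theta>. (z \<bullet> column a \<theta>) * g (column a \<theta>) \<partial>H) =
    (\<integral>\<theta>. (z \<bullet> column b \<theta>) * (column b \<theta> \<bullet> G (column a \<theta>)) \<partial>H)"
proof -
  interpret prob_space H by (rule haar_stiefelD(1)[OF H])
  define u where "u t \<theta> = cos t *\<^sub>R column a \<theta> - sin t *\<^sub>R column b \<theta>" for t and \<theta> :: "real^'d^'k"
  define w where "w t \<theta> = sin t *\<^sub>R column a \<theta> + cos t *\<^sub>R column b \<theta>" for t and \<theta> :: "real^'d^'k"
  let ?K = "2 * real CARD('k)"
  let ?C = "norm z * ?K * (\<bar>g 0\<bar> + L * ?K)"
  let ?D = "norm z * ?K * (?K * L)"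
  have contu: "continuous_on UNIV (u t)" and contw: "continuous_on UNIV (w t)" for t
    unfolding u_def w_def by (intro continuous_intros)+
  note cg = continuous_on_compose2[OF bounded_gradientD(5)[OF g] contu]
    continuous_on_compose2[OF bounded_gradientD(2)[OF g] contu]
  have meas: "\<phi> \<in> borel_measurable H" if "continuous_on UNIV \<phi>" for \<phi> :: "real^'d^'k \<Rightarrow> real"
    by (intro haar_stiefelD(4)[OF H] borel_measurable_continuous_onI that)
  have combination: "norm (x *\<^sub>R column a \<theta> + y *\<^sub>R column b \<theta>) \<le> ?K"
    if "\<theta> \<in> space H" "\<bar>x\<bar> \<le> 1" "\<bar>y\<bar> \<le> 1" for \<theta> x y
  proof -
    have "norm (x *\<^sub>R column a \<theta> + y *\<^sub>R column b \<theta>) \<le> \<bar>x\<bar> * norm (column a \<theta>) + \<bar>y\<bar> * norm (column b \<theta>)"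
      using norm_triangle_ineq[of "x *\<^sub>R column a \<theta>" "y *\<^sub>R column b \<theta>"] by simp
    also have "\<dots> \<le> 1 * real CARD('k) + 1 * real CARD('k)"
      using that norm_column_stiefel_le[of \<theta>] haar_stiefelD(2)[OF H]
      by (intro add_mono mult_mono) auto
    finally show ?thesis by simp
  qed
  have normu: "norm (u t \<theta>) \<le> ?K" and normw: "norm (w t \<theta>) \<le> ?K" if "\<theta> \<in> space H" for t \<theta>
    using combination[OF that, of "cos t" "- sin t"] combination[OF that, of "sin t" "cos t"]
    by (simp_all add: u_def w_def)
  have L: "0 \<le> L" by (rule bounded_gradientD(4)[OF g])
  have boundg: "\<bar>(z \<bullet> v) * g (u t \<theta>)\<bar> \<le> ?C" if "\<theta> \<in> space H" "norm v \<le> ?K" for t \<theta> v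
  proof -
    have "\<bar>z \<bullet> v\<bar> \<le> norm z * ?K"
      using Cauchy_Schwarz_ineq2[of z v] mult_left_mono[OF that(2), of "norm z"] by simp
    moreover have "\<bar>g (u t \<theta>)\<bar> \<le> \<bar>g 0\<bar> + L * ?K"
      using bounded_gradient_growth[OF g, of "u t \<theta>"] mult_left_mono[OF normu[OF that(1), of t] L] by simp
    ultimately show ?thesis unfolding abs_mult by (intro mult_mono) auto
  qed
  have boundG: "\<bar>(z \<bullet> v) * (v \<bullet> G (u t \<theta>))\<bar> \<le> ?D" if "\<theta> \<in> space H" "norm v \<le> ?K" for t \<theta> v
  proof -
    have "\<bar>z \<bullet> v\<bar> \<le> norm z * ?K"
      using Cauchy_Schwarz_ineq2[of z v] mult_left_mono[OF that(2), of "norm z"] by simp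
    moreover have "\<bar>v \<bullet> G (u t \<theta>)\<bar> \<le> ?K * L"
      using Cauchy_Schwarz_ineq2[of v "G (u t \<theta>)"] mult_mono[OF that(2) bounded_gradientD(3)[OF g, of "u t \<theta>"]] by simp
    ultimately show ?thesis unfolding abs_mult by (intro mult_mono) auto
  qed
  let ?h = "\<lambda>t \<theta>. (z \<bullet> w t \<theta>) * g (u t \<theta>)"
  let ?h' = "\<lambda>t \<theta>. (z \<bullet> u t \<theta>) * g (u t \<theta>) - (z \<bullet> w t \<theta>) * (w t \<theta> \<bullet> G (u t \<theta>))"
  have int1: "integrable H (\<lambda>\<theta>. (z \<bullet> u t \<theta>) * g (u t \<theta>))" for t
    by (rule integrable_const_bound[where B="?C"])
      (use boundg normu in \<open>auto intro!: meas continuous_intros contu cg\<close>)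
  have int2: "integrable H (\<lambda>\<theta>. (z \<bullet> w t \<theta>) * (w t \<theta> \<bullet> G (u t \<theta>)))" for t
    by (rule integrable_const_bound[where B="?D"])
      (use boundG normw in \<open>auto intro!: meas continuous_intros contw cg\<close>)
  have "((\<lambda>t. \<integral>\<theta>. ?h t \<theta> \<partial>H) has_real_derivative (\<integral>\<theta>. ?h' 0 \<theta> \<partial>H)) (at 0)"
  proof (rule has_real_derivative_integral_dominated[where B="\<lambda>_. ?C + ?D"])
    show "integrable H (?h t)" for t
      by (rule integrable_const_bound[where B="?C"])
        (use boundg normw in \<open>auto intro!: meas continuous_intros contw cg\<close>)
    show "((\<lambda>t. ?h t \<theta>) has_real_derivative ?h' t \<theta>) (at t)" for t \<theta>
    proof -
      have u': "((\<lambda>t. u t \<theta>) has_vector_derivative - w t \<theta>) (at t)"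
        unfolding u_def w_def has_vector_derivative_def
        by (auto intro!: derivative_eq_intros simp: algebra_simps)
      have w': "((\<lambda>t. z \<bullet> w t \<theta>) has_real_derivative z \<bullet> u t \<theta>) (at t)"
        unfolding u_def w_def inner_add_right inner_diff_right inner_scaleR_right
        by (auto intro!: derivative_eq_intros)
      show ?thesis
        using DERIV_mult[OF w' bounded_gradient_curve[OF g u']] by (simp add: algebra_simps)
    qed
    show "\<bar>?h' t \<theta>\<bar> \<le> ?C + ?D" if "\<theta> \<in> space H" for t \<theta>
      using boundg[OF that normu[OF that], of t t] boundG[OF that normw[OF that], of t t] by linarith
  qed simp
  moreover have "(\<lambda>t. \<integral>\<theta>. ?h t \<theta> \<partial>H) = (\<lambda>_. \<integral>\<theta>. ?h 0 \<theta> \<partial>H)"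
  proof
    fix t
    have "(\<integral>\<theta>. ?h 0 (\<chi> j. plane_rotation a b t (\<theta> $ j)) \<partial>H) = (\<integral>\<theta>. ?h 0 \<theta> \<partial>H)"
      by (intro haar_stiefel_invariant[OF H] orthogonal_plane_rotation[OF ab]
          borel_measurable_continuous_onI continuous_intros contw cg) auto
    moreover have "?h 0 (\<chi> j. plane_rotation a b t (\<theta> $ j)) = ?h t \<theta>" for \<theta>
    proof -
      have "column a (\<chi> j. plane_rotation a b t (\<theta> $ j)) = u t \<theta>"
        "column b (\<chi> j. plane_rotation a b t (\<theta> $ j)) = w t \<theta>"
        using ab by (auto simp: u_def w_def column_def plane_rotation_def vec_eq_iff)
      then show ?thesis by (simp add: u_def[of 0] w_def[of 0])
    qed
    ultimately show "(\<integral>\<theta>. ?h t \<theta> \<partial>H) = (\<integral>\<theta>. ?h 0 \<theta> \<partial>H)" by simp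
  qed
  ultimately have "((\<lambda>t::real. \<integral>\<theta>. ?h 0 \<theta> \<partial>H) has_real_derivative (\<integral>\<theta>. ?h' 0 \<theta> \<partial>H)) (at 0)"
    by (simp only:)
  then have "(\<integral>\<theta>. ?h' 0 \<theta> \<partial>H) = 0"
    using DERIV_unique DERIV_const by blast
  then show ?thesis using int1[of 0] int2[of 0] by (simp add: u_def w_def)
qed

text \<open>
  For \<open>k = 1\<close> this is the divergence theorem on the unit sphere of \<open>\<real>\<^sup>d\<close>, for the gradient field of the
  \<open>a\<close>-th coordinate multiplied by a function of that coordinate. In general, summing the
  rotation identity over the \<open>d - 1\<close> indices \<open>b \<noteq> a\<close> produces the
  factor \<open>d - 1\<close> on the left and, since \<open>\<Sum>\<^sub>b w\<^sub>b w\<^sub>b\<^sup>T = I\<close>, an expression in \<open>w\<^sub>a\<close> alone on the right.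
\<close>

lemma stiefel_column_stein_identity:
  fixes H :: "(real^'d^'k) measure"
  assumes H: "haar_stiefel H" and g: "bounded_gradient L g G"
  shows "(real CARD('d) - 1) * (\<integral>\<theta>. (z \<bullet> column a \<theta>) * g (column a \<theta>) \<partial>H) =
    (\<integral>\<theta>. (z - (z \<bullet> column a \<theta>) *\<^sub>R column a \<theta>) \<bullet> G (column a \<theta>) \<partial>H)"
proof -
  interpret prob_space H by (rule haar_stiefelD(1)[OF H])
  note D = bounded_gradientD[OF g]
  have int: "integrable H (\<lambda>\<theta>. (z \<bullet> column b \<theta>) * (column b \<theta> \<bullet> G (column a \<theta>)))" for b
  proof (rule integrable_const_bound[where B="(norm z * CARD('k)) * (CARD('k) * L)"], rule AE_I2)
    fix \<theta> assume "\<theta> \<in> space H"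
    then have n: "norm (column b \<theta>) \<le> CARD('k)"
      using norm_column_stiefel_le haar_stiefelD(2)[OF H] by blast
    have "\<bar>z \<bullet> column b \<theta>\<bar> \<le> norm z * CARD('k)"
      using Cauchy_Schwarz_ineq2[of z] mult_left_mono[OF n, of "norm z"] by (meson norm_ge_zero order_trans)
    moreover have "\<bar>column b \<theta> \<bullet> G (column a \<theta>)\<bar> \<le> CARD('k) * L"
      using Cauchy_Schwarz_ineq2[of "column b \<theta>" "G (column a \<theta>)"] mult_mono[OF n D(3)[of "column a \<theta>"]] by simp
    ultimately show "norm ((z \<bullet> column b \<theta>) * (column b \<theta> \<bullet> G (column a \<theta>))) \<le>
        (norm z * CARD('k)) * (CARD('k) * L)"
      unfolding real_norm_def abs_mult by (intro mult_mono) auto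
  next
    show "(\<lambda>\<theta>. (z \<bullet> column b \<theta>) * (column b \<theta> \<bullet> G (column a \<theta>))) \<in> borel_measurable H"
      by (intro haar_stiefelD(4)[OF H] borel_measurable_continuous_onI continuous_intros
          continuous_on_compose2[OF D(2)]) auto
  qed
  have "(real CARD('d) - 1) * (\<integral>\<theta>. (z \<bullet> column a \<theta>) * g (column a \<theta>) \<partial>H) =
      (\<Sum>b\<in>UNIV - {a}. \<integral>\<theta>. (z \<bullet> column a \<theta>) * g (column a \<theta>) \<partial>H)"
    by (simp add: card_Diff_singleton of_nat_diff Suc_leI)
  also have "\<dots> = (\<Sum>b\<in>UNIV - {a}. \<integral>\<theta>. (z \<bullet> column b \<theta>) * (column b \<theta> \<bullet> G (column a \<theta>)) \<partial>H)"
    by (intro sum.cong refl stiefel_column_rotation_identity[OF H g]) auto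
  also have "\<dots> = (\<integral>\<theta>. (\<Sum>b\<in>UNIV - {a}. (z \<bullet> column b \<theta>) * (column b \<theta> \<bullet> G (column a \<theta>))) \<partial>H)"
    by (rule Bochner_Integration.integral_sum[symmetric]) (rule int)
  also have "\<dots> = (\<integral>\<theta>. (z - (z \<bullet> column a \<theta>) *\<^sub>R column a \<theta>) \<bullet> G (column a \<theta>) \<partial>H)"
  proof (rule Bochner_Integration.integral_cong[OF refl])
    fix \<theta> assume "\<theta> \<in> space H"
    then have "\<theta> \<in> stiefel" using haar_stiefelD(2)[OF H] by simp
    then show "(\<Sum>b\<in>UNIV - {a}. (z \<bullet> column b \<theta>) * (column b \<theta> \<bullet> G (column a \<theta>))) =
        (z - (z \<bullet> column a \<theta>) *\<^sub>R column a \<theta>) \<bullet> G (column a \<theta>)"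
      using sum_columns_stiefel[of \<theta> z "G (column a \<theta>)"]
      by (simp add: sum_diff1 inner_diff_left)
  qed
  finally show ?thesis .
qed

text \<open>
  Some orthogonal map takes \<open>\<bar>x\<bar> e\<^sub>a\<close> to \<open>x\<close>, so by invariance the projection of a fixed vector depends on it
  only through its length.
\<close>

lemma haar_stiefel_inner_law:
  fixes H :: "(real^'d^'k) measure" and \<phi> :: "real^'k \<Rightarrow> real"
  assumes H: "haar_stiefel H" and \<phi>: "\<phi> \<in> borel_measurable borel"
  shows "(\<integral>\<theta>. \<phi> (\<chi> j. \<theta> $ j \<bullet> x) \<partial>H) = (\<integral>\<theta>. \<phi> (norm x *\<^sub>R column a \<theta>) \<partial>H)"
proof -
  define e where "e = norm x *\<^sub>R (axis a 1 :: real^'d)"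
  obtain U where U: "orthogonal_transformation U" and Ux: "U e = x"
    using orthogonal_transformation_exists[of e x] by (force simp: e_def)
  have "continuous_on UNIV (\<lambda>\<theta> :: real^'d^'k. \<chi> j. \<theta> $ j \<bullet> x)"
    by (rule continuous_on_vec_lambda) (intro continuous_on_inner continuous_on_component continuous_on_id continuous_on_const)
  from measurable_compose[OF borel_measurable_continuous_onI[OF this] \<phi>]
  have "(\<integral>\<theta>. \<phi> (\<chi> j. (\<chi> i. U (\<theta> $ i)) $ j \<bullet> x) \<partial>H) = (\<integral>\<theta>. \<phi> (\<chi> j. \<theta> $ j \<bullet> x) \<partial>H)"
    by (rule haar_stiefel_invariant[OF H U])
  then have "(\<integral>\<theta>. \<phi> (\<chi> j. \<theta> $ j \<bullet> x) \<partial>H) = (\<integral>\<theta>. \<phi> (\<chi> j. U (\<theta> $ j) \<bullet> x) \<partial>H)"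
    by (simp only: vec_lambda_beta)
  also have "(\<integral>\<theta>. \<phi> (\<chi> j. U (\<theta> $ j) \<bullet> x) \<partial>H) = (\<integral>\<theta>. \<phi> (norm x *\<^sub>R column a \<theta>) \<partial>H)"
  proof -
    have "U v \<bullet> x = v \<bullet> e" for v
    proof -
      have "U v \<bullet> U e = v \<bullet> e"
        using U unfolding orthogonal_transformation_def by blast
      then show ?thesis by (simp only: Ux)
    qed
    moreover have "(\<chi> j. \<theta> $ j \<bullet> e) = norm x *\<^sub>R column a \<theta>" for \<theta> :: "real^'d^'k"
      by (simp add: e_def inner_axis column_def vec_eq_iff)
    ultimately show ?thesis by simp
  qed
  finally show ?thesis .
qed

text \<open>
  All columns have the same law by the previous lemma, and the squares of all \<open>d k\<close> entries of a frame of \<open>k\<close> unit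
  vectors add up to \<open>k\<close>.
\<close>

lemma haar_stiefel_column_second_moment:
  fixes H :: "(real^'d^'k) measure"
  assumes H: "haar_stiefel H"
  shows "(\<integral>\<theta>. (norm (column a \<theta>))\<^sup>2 \<partial>H) = real CARD('k) / real CARD('d)"
proof -
  interpret prob_space H by (rule haar_stiefelD(1)[OF H])
  have exchange: "(\<integral>\<theta>. (norm (column b \<theta>))\<^sup>2 \<partial>H) = (\<integral>\<theta>. (norm (column a \<theta>))\<^sup>2 \<partial>H)" for b
    using haar_stiefel_inner_law[OF H, of "\<lambda>v. (norm v)\<^sup>2" "axis b 1" a]
    by (simp add: inner_axis column_def)
  have "real CARD('d) * (\<integral>\<theta>. (norm (column a \<theta>))\<^sup>2 \<partial>H) = (\<Sum>b\<in>UNIV. \<integral>\<theta>. (norm (column b \<theta>))\<^sup>2 \<partial>H)"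
    by (subst sum.cong[OF refl exchange]) simp
  also have "\<dots> = (\<integral>\<theta>. (\<Sum>b\<in>UNIV. (norm (column b \<theta>))\<^sup>2) \<partial>H)"
  proof (rule Bochner_Integration.integral_sum[symmetric])
    show "integrable H (\<lambda>\<theta>. (norm (column b \<theta>))\<^sup>2)" for b
      by (rule integrable_const_bound[where B="(real CARD('k))\<^sup>2"])
        (auto intro!: power_mono norm_column_stiefel_le haar_stiefelD(4)[OF H]
          borel_measurable_continuous_onI continuous_intros simp: haar_stiefelD(2)[OF H])
  qed
  also have "\<dots> = (\<integral>\<theta>. real CARD('k) \<partial>H)"
  proof (rule Bochner_Integration.integral_cong[OF refl])
    fix \<theta> assume "\<theta> \<in> space H"
    then have "\<theta> $ j \<bullet> \<theta> $ j = 1" for j by (simp add: haar_stiefelD(2)[OF H] stiefel_def)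
    then have "(\<Sum>j\<in>UNIV. \<theta> $ j \<bullet> \<theta> $ j) = real CARD('k)" by simp
    moreover have "(\<Sum>b\<in>UNIV. (norm (column b \<theta>))\<^sup>2) = (\<Sum>j\<in>UNIV. \<theta> $ j \<bullet> \<theta> $ j)"
      unfolding power2_norm_eq_inner inner_vec_def column_def
      by (simp, rule sum.swap)
    ultimately show "(\<Sum>b\<in>UNIV. (norm (column b \<theta>))\<^sup>2) = real CARD('k)" by simp
  qed
  finally show ?thesis by (simp add: prob_space field_simps)
qed

section \<open>Interpolation between two laws with Stein identities\<close>

text \<open>
  Put \<open>Y = sqrt d W\<close> and \<open>Y\<^sub>s = cos s Y + sin s Z\<close> with \<open>W\<close> and \<open>Z\<close> independent. The expectation
  \<open>E [(Z \<bullet> W) f(Y\<^sub>s)]\<close> can be evaluated by the formula for \<open>W\<close> with \<open>Z\<close> fixed and by the formula for \<open>Z\<close> with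
  \<open>W\<close> fixed. Comparing the two results removes the leading terms of the derivative of \<open>E f(Y\<^sub>s)\<close>, which becomes
  \<open>cos s / (d - 1) * E [((Z \<bullet> Y) Y - Z) \<bullet> \<nabla>f(Y\<^sub>s)]\<close>. Only the gradient of \<open>f\<close> is left, so its size is at most
  \<open>cos s / (d - 1) * (k + sqrt k)\<close>, where \<open>k\<close> is the dimension, and \<open>cos\<close> has integral \<open>1\<close> over the path.

  The second moments of \<open>Z\<close> are the cases of its own formula in which \<open>g\<close> is linear.
\<close>

lemma stein_smart_path_bound:
  fixes W :: "'a \<Rightarrow> 'c::euclidean_space" and Z :: "'b \<Rightarrow> 'c" and d :: real
  assumes M: "prob_space M" and N: "prob_space N"
    and W: "W \<in> borel_measurable M" and W_bound: "\<And>\<omega>. \<omega> \<in> space M \<Longrightarrow> norm (W \<omega>) \<le> B"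
    and W_second: "(\<integral>\<omega>. (norm (W \<omega>))\<^sup>2 \<partial>M) = DIM('c) / d" and d: "d > 1"
    and W_stein: "\<And>L g G z. bounded_gradient L g G \<Longrightarrow>
      (d - 1) * (\<integral>\<omega>. (z \<bullet> W \<omega>) * g (W \<omega>) \<partial>M) =
      (\<integral>\<omega>. (z - (z \<bullet> W \<omega>) *\<^sub>R W \<omega>) \<bullet> G (W \<omega>) \<partial>M)"
    and Z: "Z \<in> borel_measurable N" and Z_sq: "integrable N (\<lambda>\<omega>. (norm (Z \<omega>))\<^sup>2)"
    and Z_stein: "\<And>L g G v. bounded_gradient L g G \<Longrightarrow>
      (\<integral>\<omega>. (Z \<omega> \<bullet> v) * g (Z \<omega>) \<partial>N) = (\<integral>\<omega>. v \<bullet> G (Z \<omega>) \<partial>N)"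
    and f: "bounded_gradient 1 f G"
  shows "\<bar>(\<integral>\<omega>. f (Z \<omega>) \<partial>N) - (\<integral>\<omega>. f (sqrt d *\<^sub>R W \<omega>) \<partial>M)\<bar> \<le> (DIM('c) + sqrt DIM('c)) / (d - 1)"
proof -
  interpret M: prob_space M by (rule M)
  interpret N: prob_space N by (rule N)
  interpret P: pair_prob_space N M by unfold_locales
  note [measurable] = W Z bounded_gradient_measurable[OF f]
  let ?P = "N \<Otimes>\<^sub>M M"
  \<comment> \<open>The Gaussian factor comes first in the product: it is the unbounded one, and its integrability passes to the first component directly.\<close>
  define r where "r = sqrt d"
  define V where "V p = W (snd p)" for p :: "'b \<times> 'a"
  define U where "U p = Z (fst p)" for p :: "'b \<times> 'a"
  have [measurable]: "V \<in> borel_measurable ?P" "U \<in> borel_measurable ?P"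
    unfolding V_def U_def by measurable
  have r: "r > 0" "r\<^sup>2 = d" using d by (auto simp: r_def)
  have V_bound: "norm (V p) \<le> B" if "p \<in> space ?P" for p
    using that W_bound by (auto simp: V_def space_pair_measure)
  have U_sq: "integrable ?P (\<lambda>p. (norm (U p))\<^sup>2)"
    unfolding U_def
    by (rule integrable_distr[of fst ?P N "\<lambda>x. (norm (Z x))\<^sup>2"]) (simp_all add: M.distr_pair_fst Z_sq)
  have B: "0 \<le> B"
    using W_bound M.not_empty norm_ge_zero order_trans by blast
  have U_norm: "integrable ?P (\<lambda>p. norm (U p))"
    by (rule integrable_norm_of_square[OF P.P.finite_measure_axioms _ U_sq]) measurable

  define Y where "Y s p = (cos s * r) *\<^sub>R V p + sin s *\<^sub>R U p" for s p
  have [measurable]: "Y s \<in> borel_measurable ?P" for s unfolding Y_def by measurable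
  have G_bound: "norm (G x) \<le> 1" for x by (rule bounded_gradientD(3)[OF f])
  have inner_G: "\<bar>v \<bullet> G x\<bar> \<le> norm v" for v x
    using Cauchy_Schwarz_ineq2[of v "G x"] mult_left_mono[OF G_bound[of x], of "norm v"] by simp
  have int_bound: "integrable ?P \<phi>"
    if [measurable]: "\<phi> \<in> borel_measurable ?P" and "\<And>p. p \<in> space ?P \<Longrightarrow> \<bar>\<phi> p\<bar> \<le> a + b * norm (U p)"
    for \<phi> :: "'b \<times> 'a \<Rightarrow> real" and a b
    by (rule Bochner_Integration.integrable_bound[where f="\<lambda>p. a + b * norm (U p)"])
      (use U_norm that(2) in \<open>auto intro!: AE_I2 order_trans[OF _ abs_ge_self]\<close>)
  have int_UV: "\<bar>U p \<bullet> V p\<bar> \<le> B * norm (U p)" if "p \<in> space ?P" for p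
    using Cauchy_Schwarz_ineq2[of "U p" "V p"] mult_left_mono[OF V_bound[OF that], of "norm (U p)"]
    by (simp add: mult.commute)
  have f_bound: "\<bar>f (Y s p)\<bar> \<le> (\<bar>f 0\<bar> + r * B) + norm (U p)" if "p \<in> space ?P" for s p
  proof -
    have "norm (Y s p) \<le> \<bar>cos s\<bar> * (r * norm (V p)) + \<bar>sin s\<bar> * norm (U p)"
      using norm_triangle_ineq[of "(cos s * r) *\<^sub>R V p" "sin s *\<^sub>R U p"] r
      by (simp add: Y_def abs_mult)
    also have "\<dots> \<le> 1 * (r * B) + 1 * norm (U p)"
      using V_bound[OF that] r by (intro add_mono mult_mono) auto
    finally show ?thesis using bounded_gradient_growth[OF f, of "Y s p"] by simp
  qed
  have int_f: "integrable ?P (\<lambda>p. f (Y s p))" for s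
    by (rule int_bound[of _ "\<bar>f 0\<bar> + r * B" 1]) (use f_bound in auto)
  have int_VG: "integrable ?P (\<lambda>p. V p \<bullet> G (Y s p))" for s
    by (rule int_bound[of _ B 0]) (use inner_G V_bound order_trans in \<open>auto, blast\<close>)
  have int_UG: "integrable ?P (\<lambda>p. U p \<bullet> G (Y s p))" for s
    by (rule int_bound[of _ 0 1]) (use inner_G in auto)
  have int_UVG: "integrable ?P (\<lambda>p. (U p \<bullet> V p) * (V p \<bullet> G (Y s p)))" for s
  proof (rule int_bound[of _ 0 "B * B"])
    fix p assume p: "p \<in> space ?P"
    have "\<bar>U p \<bullet> V p\<bar> * \<bar>V p \<bullet> G (Y s p)\<bar> \<le> (B * norm (U p)) * B"
      using int_UV[OF p] inner_G[of "V p"] V_bound[OF p] B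
      by (intro mult_mono order_trans[OF inner_G V_bound[OF p]]) auto
    then show "\<bar>(U p \<bullet> V p) * (V p \<bullet> G (Y s p))\<bar> \<le> 0 + B * B * norm (U p)"
      by (simp add: abs_mult mult_ac)
  qed measurable
  have int_UVf: "integrable ?P (\<lambda>p. (U p \<bullet> V p) * f (Y s p))" for s
  proof (rule Bochner_Integration.integrable_bound[where f="\<lambda>p. B * (\<bar>f 0\<bar> + r * B) * norm (U p) + B * (norm (U p))\<^sup>2"])
    show "AE p in ?P. norm ((U p \<bullet> V p) * f (Y s p)) \<le>
        norm (B * (\<bar>f 0\<bar> + r * B) * norm (U p) + B * (norm (U p))\<^sup>2)"
    proof (rule AE_I2)
      fix p assume p: "p \<in> space ?P"
      have "\<bar>(U p \<bullet> V p) * f (Y s p)\<bar> \<le> (B * norm (U p)) * ((\<bar>f 0\<bar> + r * B) + norm (U p))"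
        unfolding abs_mult using int_UV[OF p] f_bound[OF p, of s] B by (intro mult_mono) auto
      also have "\<dots> = B * (\<bar>f 0\<bar> + r * B) * norm (U p) + B * (norm (U p))\<^sup>2"
        by (simp add: algebra_simps power2_eq_square)
      finally show "norm ((U p \<bullet> V p) * f (Y s p)) \<le>
          norm (B * (\<bar>f 0\<bar> + r * B) * norm (U p) + B * (norm (U p))\<^sup>2)"
        by simp
    qed
  qed (use U_norm U_sq in auto)

  \<comment> \<open>Fubini with the inner integral over \<open>W\<close>, then over \<open>Z\<close>: two evaluations of the same expectation.\<close>
  have sphere: "(d - 1) * (\<integral>p. (U p \<bullet> V p) * f (Y s p) \<partial>?P) =
      cos s * r * ((\<integral>p. U p \<bullet> G (Y s p) \<partial>?P) - (\<integral>p. (U p \<bullet> V p) * (V p \<bullet> G (Y s p)) \<partial>?P))" for s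
  proof -
    let ?c = "cos s * r"
    have "(d - 1) * (\<integral>p. (U p \<bullet> V p) * f (Y s p) \<partial>?P) =
        (\<integral>x. (d - 1) * (\<integral>y. (Z x \<bullet> W y) * f (?c *\<^sub>R W y + sin s *\<^sub>R Z x) \<partial>M) \<partial>N)"
      using P.integral_fst'[OF int_UVf[of s], symmetric] by (simp add: U_def V_def Y_def)
    also have "\<dots> = (\<integral>x. (\<integral>y. (Z x - (Z x \<bullet> W y) *\<^sub>R W y) \<bullet> (?c *\<^sub>R G (?c *\<^sub>R W y + sin s *\<^sub>R Z x)) \<partial>M) \<partial>N)"
      by (simp only: W_stein[OF bounded_gradient_affine[OF f]])
    also have "\<dots> = (\<integral>x. (\<integral>y. ?c * (Z x \<bullet> G (?c *\<^sub>R W y + sin s *\<^sub>R Z x) -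
        (Z x \<bullet> W y) * (W y \<bullet> G (?c *\<^sub>R W y + sin s *\<^sub>R Z x))) \<partial>M) \<partial>N)"
      by (simp add: inner_diff_left algebra_simps)
    also have "\<dots> = (\<integral>p. ?c * (U p \<bullet> G (Y s p) - (U p \<bullet> V p) * (V p \<bullet> G (Y s p))) \<partial>?P)"
      using P.integral_fst'[OF integrable_mult_right[OF Bochner_Integration.integrable_diff[OF int_UG[of s] int_UVG[of s]]], of ?c]
      by (simp add: U_def V_def Y_def)
    finally show ?thesis using int_UG[of s] int_UVG[of s] by simp
  qed
  have gauss: "(\<integral>p. (U p \<bullet> V p) * f (Y s p) \<partial>?P) = sin s * (\<integral>p. V p \<bullet> G (Y s p) \<partial>?P)" for s
  proof -
    let ?c = "cos s * r"
    have "(\<integral>p. (U p \<bullet> V p) * f (Y s p) \<partial>?P) =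
        (\<integral>y. (\<integral>x. (Z x \<bullet> W y) * f (sin s *\<^sub>R Z x + ?c *\<^sub>R W y) \<partial>N) \<partial>M)"
      using P.integral_snd[of "\<lambda>x y. (Z x \<bullet> W y) * f (sin s *\<^sub>R Z x + ?c *\<^sub>R W y)"] int_UVf[of s]
      by (simp add: U_def V_def Y_def case_prod_beta' add.commute)
    also have "\<dots> = (\<integral>y. (\<integral>x. W y \<bullet> (sin s *\<^sub>R G (sin s *\<^sub>R Z x + ?c *\<^sub>R W y)) \<partial>N) \<partial>M)"
      by (simp only: Z_stein[OF bounded_gradient_affine[OF f]])
    also have "\<dots> = (\<integral>p. sin s * (V p \<bullet> G (Y s p)) \<partial>?P)"
      using P.integral_snd[of "\<lambda>x y. W y \<bullet> (sin s *\<^sub>R G (sin s *\<^sub>R Z x + ?c *\<^sub>R W y))"]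
        integrable_mult_right[OF int_VG[of s], of "sin s"]
      by (simp add: U_def V_def Y_def case_prod_beta' add.commute)
    finally show ?thesis by simp
  qed

  have V_second: "(\<integral>p. (norm (V p))\<^sup>2 \<partial>?P) = DIM('c) / d"
  proof -
    have "integrable ?P (\<lambda>p. (norm (V p))\<^sup>2)"
      by (rule int_bound[of _ "B\<^sup>2" 0]) (auto intro!: power_mono V_bound)
    from P.integral_fst'[OF this] show ?thesis by (simp add: V_def W_second N.prob_space)
  qed
  have Z_inner: "(\<integral>x. (Z x \<bullet> v)\<^sup>2 \<partial>N) = (norm v)\<^sup>2" for v
    using Z_stein[OF bounded_gradient_inner[of v], of v]
    by (simp add: power2_eq_square N.prob_space flip: power2_norm_eq_inner)
  have int_UV2: "integrable ?P (\<lambda>p. (U p \<bullet> V p)\<^sup>2)"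
  proof (rule Bochner_Integration.integrable_bound[where f="\<lambda>p. B\<^sup>2 * (norm (U p))\<^sup>2"])
    show "AE p in ?P. norm ((U p \<bullet> V p)\<^sup>2) \<le> norm (B\<^sup>2 * (norm (U p))\<^sup>2)"
      using power_mono[OF int_UV, of _ 2] by (auto intro!: AE_I2 simp: power_mult_distrib)
  qed (use U_sq in auto)
  have UV_second: "(\<integral>p. (U p \<bullet> V p)\<^sup>2 \<partial>?P) = DIM('c) / d"
  proof -
    have "(\<integral>p. (U p \<bullet> V p)\<^sup>2 \<partial>?P) = (\<integral>y. (\<integral>x. (Z x \<bullet> W y)\<^sup>2 \<partial>N) \<partial>M)"
      using P.integral_snd[of "\<lambda>x y. (Z x \<bullet> W y)\<^sup>2"] int_UV2 by (simp add: U_def V_def case_prod_beta')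
    then show ?thesis by (simp add: Z_inner W_second)
  qed
  have U_second: "(\<integral>p. (norm (U p))\<^sup>2 \<partial>?P) = DIM('c)"
  proof -
    have int: "integrable N (\<lambda>x. (Z x \<bullet> b)\<^sup>2)" if "b \<in> Basis" for b
      by (rule Bochner_Integration.integrable_bound[OF Z_sq])
        (use that Basis_le_norm[OF that] in \<open>auto intro!: AE_I2 simp flip: abs_le_square_iff\<close>)
    have "(\<integral>p. (norm (U p))\<^sup>2 \<partial>?P) = (\<integral>x. (norm (Z x))\<^sup>2 \<partial>N)"
      using P.integral_fst'[OF U_sq] by (simp add: U_def M.prob_space)
    also have "\<dots> = (\<integral>x. (\<Sum>b\<in>Basis. (Z x \<bullet> b)\<^sup>2) \<partial>N)"
      by (simp add: power2_norm_eq_inner euclidean_inner[of "Z _" "Z _"] flip: power2_eq_square)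
    also have "\<dots> = (\<Sum>b\<in>(Basis :: 'c set). 1)"
      using int by (simp add: Z_inner)
    finally show ?thesis by simp
  qed

  define k where "k = real DIM('c)"
  have k: "k > 0" by (simp add: k_def)
  let ?K = "(k + sqrt k) / (d - 1)"
  let ?F = "\<lambda>s. \<integral>p. f (Y s p) \<partial>?P"
  let ?F' = "\<lambda>s. \<integral>p. (cos s *\<^sub>R U p - (sin s * r) *\<^sub>R V p) \<bullet> G (Y s p) \<partial>?P"
  have deriv: "(?F has_real_derivative ?F' s) (at s)" for s
  proof (rule has_real_derivative_integral_dominated[where B="\<lambda>p. r * B + norm (U p)"])
    show "((\<lambda>s. f (Y s p)) has_real_derivative (cos s *\<^sub>R U p - (sin s * r) *\<^sub>R V p) \<bullet> G (Y s p)) (at s)" for s p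
    proof -
      have "((\<lambda>s. Y s p) has_vector_derivative cos s *\<^sub>R U p - (sin s * r) *\<^sub>R V p) (at s)"
        unfolding Y_def has_vector_derivative_def
        by (auto intro!: derivative_eq_intros simp: algebra_simps)
      from bounded_gradient_curve[OF f this] show ?thesis .
    qed
    show "\<bar>(cos s *\<^sub>R U p - (sin s * r) *\<^sub>R V p) \<bullet> G (Y s p)\<bar> \<le> r * B + norm (U p)" if "p \<in> space ?P" for s p
    proof -
      have "norm (cos s *\<^sub>R U p - (sin s * r) *\<^sub>R V p) \<le> \<bar>cos s\<bar> * norm (U p) + \<bar>sin s\<bar> * (r * norm (V p))"
        using norm_triangle_ineq4[of "cos s *\<^sub>R U p" "(sin s * r) *\<^sub>R V p"] r by (simp add: abs_mult)
      also have "\<dots> \<le> 1 * norm (U p) + 1 * (r * B)"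
        using V_bound[OF that] r by (intro add_mono mult_mono) auto
      finally show ?thesis using inner_G[of "cos s *\<^sub>R U p - (sin s * r) *\<^sub>R V p" "Y s p"] by linarith
    qed
  qed (use int_f U_norm in auto)
  \<comment> \<open>With \<open>V\<close> in place of \<open>Y = r V\<close>, the factor \<open>r\<^sup>2\<close> becomes the coefficient \<open>d\<close>.\<close>
  have F'_eq: "(d - 1) * ?F' s =
      cos s * (\<integral>p. d * ((U p \<bullet> V p) * (V p \<bullet> G (Y s p))) - U p \<bullet> G (Y s p) \<partial>?P)" for s
  proof -
    let ?u = "\<integral>p. U p \<bullet> G (Y s p) \<partial>?P" and ?v = "\<integral>p. V p \<bullet> G (Y s p) \<partial>?P"
      and ?uv = "\<integral>p. (U p \<bullet> V p) * (V p \<bullet> G (Y s p)) \<partial>?P"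
    have path: "?F' s = cos s * ?u - r * sin s * ?v"
      using int_UG[of s] int_VG[of s] by (simp add: inner_diff_left mult_ac)
    have exchange: "(d - 1) * (sin s * ?v) = cos s * r * (?u - ?uv)"
      using sphere[of s] gauss[of s] by simp
    have "(d - 1) * ?F' s = (d - 1) * (cos s * ?u) - r * ((d - 1) * (sin s * ?v))"
      unfolding path by (simp add: algebra_simps)
    also have "\<dots> = (d - 1) * (cos s * ?u) - r * (cos s * r * (?u - ?uv))"
      unfolding exchange ..
    also have "\<dots> = (d - 1) * (cos s * ?u) - r\<^sup>2 * (cos s * (?u - ?uv))"
      by (simp add: power2_eq_square)
    also have "\<dots> = cos s * (d * ?uv - ?u)"
      unfolding r(2) by (simp add: algebra_simps)
    finally show ?thesis using int_UG[of s] int_UVG[of s] by simp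
  qed
  have F'_bound: "\<bar>?F' s\<bar> \<le> ?K * cos s" if "0 \<le> cos s" for s
  proof -
    \<comment> \<open>Both products are bounded by means of squares whose expectations are known: \<open>E (U \<bullet> V)\<^sup>2 = E \<bar>V\<bar>\<^sup>2 = k / d\<close> and \<open>E \<bar>U\<bar>\<^sup>2 = k\<close>.\<close>
    let ?B = "\<lambda>p. d / 2 * ((U p \<bullet> V p)\<^sup>2 + (norm (V p))\<^sup>2) + ((norm (U p))\<^sup>2 / sqrt k + sqrt k) / 2"
    have int_V2: "integrable ?P (\<lambda>p. (norm (V p))\<^sup>2)"
      by (rule int_bound[of _ "B\<^sup>2" 0]) (auto intro!: power_mono V_bound)
    have "norm (\<integral>p. d * ((U p \<bullet> V p) * (V p \<bullet> G (Y s p))) - U p \<bullet> G (Y s p) \<partial>?P) \<le> (\<integral>p. ?B p \<partial>?P)"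
    proof (rule lebesgue_integral_norm_bound)
      show "integrable ?P ?B" using int_UV2 int_V2 U_sq by simp
      show "norm (d * ((U p \<bullet> V p) * (V p \<bullet> G (Y s p))) - U p \<bullet> G (Y s p)) \<le> ?B p" for p
      proof -
        have "\<bar>(U p \<bullet> V p) * (V p \<bullet> G (Y s p))\<bar> \<le> \<bar>U p \<bullet> V p\<bar> * norm (V p)"
          unfolding abs_mult by (intro mult_left_mono inner_G) simp
        also have "\<dots> \<le> ((U p \<bullet> V p)\<^sup>2 + (norm (V p))\<^sup>2) / 2"
          using sum_squares_bound[of "\<bar>U p \<bullet> V p\<bar>" "norm (V p)"] by simp
        finally have "d * \<bar>(U p \<bullet> V p) * (V p \<bullet> G (Y s p))\<bar> \<le> d / 2 * ((U p \<bullet> V p)\<^sup>2 + (norm (V p))\<^sup>2)"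
          using mult_left_mono[of _ _ d] d by fastforce
        moreover have "norm (U p) \<le> ((norm (U p))\<^sup>2 / sqrt k + sqrt k) / 2"
          by (rule le_average_square_quotient) (simp add: k)
        moreover have "\<bar>d * ((U p \<bullet> V p) * (V p \<bullet> G (Y s p)))\<bar> = d * \<bar>(U p \<bullet> V p) * (V p \<bullet> G (Y s p))\<bar>"
          using d by (simp add: abs_mult)
        ultimately show ?thesis using inner_G[of "U p" "Y s p"] unfolding real_norm_def by linarith
      qed
    qed (use int_UVG[of s] int_UG[of s] in simp)
    also have "(\<integral>p. ?B p \<partial>?P) = d / 2 * (k / d + k / d) + (k / sqrt k + sqrt k) / 2"
      using int_UV2 int_V2 U_sq UV_second V_second U_second by (simp add: k_def P.P.prob_space)
    also have "\<dots> = k + sqrt k" using d k by (simp add: real_div_sqrt)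
    finally have "\<bar>(d - 1) * ?F' s\<bar> \<le> cos s * (k + sqrt k)"
      unfolding F'_eq using that by (simp add: abs_mult mult_left_mono)
    then show ?thesis using d by (simp add: abs_mult field_simps)
  qed
  have "0 \<le> cos s" if "0 \<le> s" "s \<le> pi/2" for s using that by (intro cos_ge_zero) auto
  note F'_bound = F'_bound[OF this]
  \<comment> \<open>Comparison of \<open>?F\<close> with \<open>?K * sin\<close>, whose derivative is the bound just obtained.\<close>
  have "?F (pi/2) - ?K * sin (pi/2) \<le> ?F 0 - ?K * sin 0"
  proof (rule DERIV_nonpos_imp_nonincreasing[where f="\<lambda>s. ?F s - ?K * sin s"])
    fix s assume "0 \<le> s" "s \<le> pi/2"
    then show "\<exists>y. ((\<lambda>s. ?F s - ?K * sin s) has_real_derivative y) (at s) \<and> y \<le> 0"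
      using F'_bound[of s] d
      by (intro exI[of _ "?F' s - ?K * cos s"]) (auto intro!: derivative_eq_intros deriv simp: abs_le_iff)
  qed simp
  moreover have "?F 0 + ?K * sin 0 \<le> ?F (pi/2) + ?K * sin (pi/2)"
  proof (rule DERIV_nonneg_imp_nondecreasing[where f="\<lambda>s. ?F s + ?K * sin s"])
    fix s assume "0 \<le> s" "s \<le> pi/2"
    then show "\<exists>y. ((\<lambda>s. ?F s + ?K * sin s) has_real_derivative y) (at s) \<and> 0 \<le> y"
      using F'_bound[of s] d
      by (intro exI[of _ "?F' s + ?K * cos s"]) (auto intro!: derivative_eq_intros deriv simp: abs_le_iff)
  qed simp
  moreover have "?F (pi/2) = (\<integral>\<omega>. f (Z \<omega>) \<partial>N)"
    using P.integral_fst'[OF int_f[of "pi/2"]] by (simp add: Y_def U_def M.prob_space)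
  moreover have "?F 0 = (\<integral>\<omega>. f (sqrt d *\<^sub>R W \<omega>) \<partial>M)"
    using P.integral_fst'[OF int_f[of 0]] by (simp add: Y_def V_def r_def N.prob_space)
  ultimately show ?thesis by (simp add: k_def abs_le_iff)
qed

section \<open>Projections of a point set\<close>

lemma Lipschitz_bound:
  assumes "1-lipschitz_on UNIV (f :: 'c::euclidean_space \<Rightarrow> real)"
  shows "\<bar>f u - f v\<bar> \<le> norm (u - v)" "\<bar>f v\<bar> \<le> \<bar>f 0\<bar> + norm v" "f \<in> borel_measurable borel"
proof -
  show 1: "\<bar>f u - f v\<bar> \<le> norm (u - v)" for u v
    using lipschitz_onD[OF assms, of u v] by (simp add: dist_norm)
  show "\<bar>f v\<bar> \<le> \<bar>f 0\<bar> + norm v" using 1[of v 0] by simp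
  show "f \<in> borel_measurable borel"
    using lipschitz_on_continuous_on[OF assms] by (rule borel_measurable_continuous_onI)
qed

lemma integrable_Lipschitz:
  fixes f :: "'c::euclidean_space \<Rightarrow> real"
  assumes "prob_space M" and f: "1-lipschitz_on UNIV f"
    and [measurable]: "Z \<in> borel_measurable M" and int: "integrable M (\<lambda>\<omega>. norm (Z \<omega>))"
  shows "integrable M (\<lambda>\<omega>. f (Z \<omega>))"
proof -
  interpret prob_space M by fact
  note [measurable] = Lipschitz_bound(3)[OF f]
  show ?thesis
  proof (rule Bochner_Integration.integrable_bound[of _ "\<lambda>\<omega>. \<bar>f 0\<bar> + norm (Z \<omega>)"])
    show "AE \<omega> in M. norm (f (Z \<omega>)) \<le> norm (\<bar>f 0\<bar> + norm (Z \<omega>))"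
      using Lipschitz_bound(2)[OF f] by simp
  qed (use int in simp_all)
qed

text \<open>
  A uniform approximation changes both expectations by at most \<open>\<epsilon> / 2\<close>, so a bound for smooth test
  functions extends to all Lipschitz ones with the same constant.
\<close>

lemma Lipschitz_difference_le_of_smooth:
  fixes f :: "'c::euclidean_space \<Rightarrow> real"
  assumes M: "prob_space M" and N: "prob_space N" and f: "1-lipschitz_on UNIV f"
    and U: "U \<in> borel_measurable M" "integrable M (\<lambda>\<omega>. norm (U \<omega>))"
    and V: "V \<in> borel_measurable N" "integrable N (\<lambda>\<omega>. norm (V \<omega>))"
    and smooth: "\<And>g G. bounded_gradient 1 g G \<Longrightarrow> \<bar>(\<integral>\<omega>. g (V \<omega>) \<partial>N) - (\<integral>\<omega>. g (U \<omega>) \<partial>M)\<bar> \<le> C"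
  shows "\<bar>(\<integral>\<omega>. f (V \<omega>) \<partial>N) - (\<integral>\<omega>. f (U \<omega>) \<partial>M)\<bar> \<le> C"
proof (rule field_le_epsilon)
  fix \<epsilon> :: real assume "\<epsilon> > 0"
  then obtain g G where g: "bounded_gradient 1 g G" and close: "\<And>x. \<bar>g x - f x\<bar> \<le> \<epsilon> / 2"
    using smooth_approximation[OF f, of "\<epsilon> / 2"] by auto
  have lip: "1-lipschitz_on UNIV g"
    by (rule lipschitz_onI) (use bounded_gradient_Lipschitz[OF g] in \<open>auto simp: dist_norm\<close>)
  have approx: "\<bar>(\<integral>\<omega>. g (R \<omega>) \<partial>K) - (\<integral>\<omega>. f (R \<omega>) \<partial>K)\<bar> \<le> \<epsilon> / 2"
    if K: "prob_space K" and R: "R \<in> borel_measurable K" "integrable K (\<lambda>\<omega>. norm (R \<omega>))"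
    for K and R :: "'z \<Rightarrow> 'c"
  proof -
    interpret prob_space K by (rule K)
    have ints: "integrable K (\<lambda>\<omega>. g (R \<omega>))" "integrable K (\<lambda>\<omega>. f (R \<omega>))"
      using integrable_Lipschitz[OF K _ R] lip f by auto
    have "norm (\<integral>\<omega>. g (R \<omega>) - f (R \<omega>) \<partial>K) \<le> (\<integral>\<omega>. \<epsilon> / 2 \<partial>K)"
      by (rule lebesgue_integral_norm_bound) (use close ints in auto)
    then show ?thesis using ints by (simp add: prob_space)
  qed
  show "\<bar>(\<integral>\<omega>. f (V \<omega>) \<partial>N) - (\<integral>\<omega>. f (U \<omega>) \<partial>M)\<bar> \<le> C + \<epsilon>"
    using smooth[OF g] approx[OF M U] approx[OF N V] by linarith
qed

lemma stiefel_column_norm_integrable: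
  fixes H :: "(real^'d^'k) measure"
  assumes H: "haar_stiefel H"
  shows "column a \<in> borel_measurable H" "integrable H (\<lambda>\<theta>. norm (column a \<theta>))"
    "(\<integral>\<theta>. norm (column a \<theta>) \<partial>H) \<le> sqrt (real CARD('k) / real CARD('d))"
proof -
  interpret prob_space H by (rule haar_stiefelD(1)[OF H])
  let ?m = "real CARD('k) / real CARD('d)"
  show meas: "column a \<in> borel_measurable H"
    by (intro haar_stiefelD(4)[OF H] borel_measurable_continuous_onI continuous_intros)
  have bound: "norm (column a \<theta>) \<le> CARD('k)" if "\<theta> \<in> space H" for \<theta>
    using that norm_column_stiefel_le haar_stiefelD(2)[OF H] by blast
  show int: "integrable H (\<lambda>\<theta>. norm (column a \<theta>))"
    by (rule integrable_const_bound[where B="CARD('k)"]) (use bound meas in auto)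
  have int2: "integrable H (\<lambda>\<theta>. (norm (column a \<theta>))\<^sup>2)"
    by (rule integrable_const_bound[where B="(real CARD('k))\<^sup>2"])
      (use bound meas in \<open>auto intro!: power_mono\<close>)
  define s where "s = sqrt ?m"
  have s: "s > 0" "?m = s\<^sup>2" by (simp_all add: s_def)
  have "(\<integral>\<theta>. norm (column a \<theta>) \<partial>H) \<le> (\<integral>\<theta>. ((norm (column a \<theta>))\<^sup>2 / s + s) / 2 \<partial>H)"
    by (rule integral_mono[OF int]) (use int2 le_average_square_quotient[OF s(1)] in simp_all)
  also have "\<dots> = (s\<^sup>2 / s + s) / 2"
    unfolding s(2)[symmetric] haar_stiefel_column_second_moment[OF H, of a, symmetric]
    using int2 by (simp add: prob_space)
  also have "\<dots> = s" using s(1) by (simp add: power2_eq_square)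
  finally show "(\<integral>\<theta>. norm (column a \<theta>) \<partial>H) \<le> sqrt ?m" by (simp add: s_def)
qed

lemma stiefel_column_gaussian_bound:
  fixes H :: "(real^'d^'k) measure" and Z :: "'b \<Rightarrow> real^'k"
  assumes H: "haar_stiefel H" and d: "CARD('d) \<ge> 2"
    and N: "prob_space N" and Z: "std_normal_vector N Z" and f: "1-lipschitz_on UNIV f"
  shows "\<bar>(\<integral>\<omega>. f (Z \<omega>) \<partial>N) - (\<integral>\<theta>. f (sqrt (real CARD('d)) *\<^sub>R column a \<theta>) \<partial>H)\<bar>
    \<le> (real CARD('k) + sqrt (real CARD('k))) / (real CARD('d) - 1)"
proof (rule Lipschitz_difference_le_of_smooth[OF haar_stiefelD(1)[OF H] N f])
  note Zm = std_normal_vector_measurable[OF Z] and Zsq = std_normal_vector_square_integrable[OF Z]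
  show "Z \<in> borel_measurable N" by (rule Zm)
  show "integrable N (\<lambda>\<omega>. norm (Z \<omega>))"
    by (rule integrable_norm_of_square[OF prob_space.finite_measure[OF N] Zm Zsq])
  note W = stiefel_column_norm_integrable[OF H, of a]
  show "(\<lambda>\<theta>. sqrt (real CARD('d)) *\<^sub>R column a \<theta>) \<in> borel_measurable H"
    using W(1) by measurable
  show "integrable H (\<lambda>\<theta>. norm (sqrt (real CARD('d)) *\<^sub>R column a \<theta>))"
    using W(2) by simp
  fix g G assume g: "bounded_gradient 1 g (G :: real^'k \<Rightarrow> real^'k)"
  have "\<bar>(\<integral>\<omega>. g (Z \<omega>) \<partial>N) - (\<integral>\<theta>. g (sqrt (real CARD('d)) *\<^sub>R column a \<theta>) \<partial>H)\<bar>
    \<le> (DIM(real^'k) + sqrt (DIM(real^'k))) / (real CARD('d) - 1)"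
  proof (rule stein_smart_path_bound[OF haar_stiefelD(1)[OF H] N W(1) _ _ _ _ Zm Zsq _ g])
    show "norm (column a \<theta>) \<le> CARD('k)" if "\<theta> \<in> space H" for \<theta>
      using that norm_column_stiefel_le haar_stiefelD(2)[OF H] by blast
    show "(\<integral>\<theta>. (norm (column a \<theta>))\<^sup>2 \<partial>H) = DIM(real^'k) / real CARD('d)"
      using haar_stiefel_column_second_moment[OF H, of a] by simp
    show "1 < real CARD('d)" using d by simp
  qed (fact stiefel_column_stein_identity[OF H] std_normal_vector_integration_by_parts[OF N Z])+
  then show "\<bar>(\<integral>\<omega>. g (Z \<omega>) \<partial>N) - (\<integral>\<theta>. g (sqrt (real CARD('d)) *\<^sub>R column a \<theta>) \<partial>H)\<bar>
    \<le> (real CARD('k) + sqrt (real CARD('k))) / (real CARD('d) - 1)"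
    by simp
qed

lemma projection_measurable:
  "(\<lambda>\<theta> :: real^'d^'k. \<chi> j. \<theta> $ j \<bullet> y) \<in> borel_measurable borel"
  by (rule borel_measurable_continuous_onI, rule continuous_on_vec_lambda)
    (intro continuous_on_inner continuous_on_component continuous_on_id continuous_on_const)

text \<open>
  Unconditionally, \<open>X\<close> is obtained by choosing an index \<open>i\<close> uniformly and, independently, a frame from its law, and
  projecting \<open>x\<^sub>i\<close>: the conditional law is the section of the product measure at a fixed frame.
\<close>

lemma expectation_conditional_law_proj_empirical:
  fixes x :: "nat \<Rightarrow> real^'d" and \<theta> :: "'a \<Rightarrow> real^'d^'k" and X :: "'a \<Rightarrow> real^'k"
    and \<phi> :: "real^'k \<Rightarrow> real"
  assumes n: "n \<ge> 1" and H: "haar_stiefel (distr M stiefel_borel \<theta>)"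
    and cond: "conditional_law M stiefel_borel \<theta> borel X (proj_empirical n x)"
    and [measurable]: "\<phi> \<in> borel_measurable borel" and growth: "\<And>v. \<bar>\<phi> v\<bar> \<le> c + norm v"
  shows "integrable M (\<lambda>\<omega>. \<phi> (X \<omega>))"
    and "(\<integral>\<omega>. \<phi> (X \<omega>) \<partial>M) =
      (\<Sum>i=1..n. \<integral>t. \<phi> (\<chi> j. t $ j \<bullet> x i) \<partial>distr M stiefel_borel \<theta>) / real n"
proof -
  let ?H = "distr M stiefel_borel \<theta>" and ?U = "uniform_count_measure {1..n}"
  let ?p = "\<lambda>(i, t :: real^'d^'k). \<chi> j. t $ j \<bullet> x i"
  have X [measurable]: "X \<in> borel_measurable M" and \<theta>: "\<theta> \<in> M \<rightarrow>\<^sub>M stiefel_borel"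
    using cond by (auto simp: conditional_law_def)
  interpret H: prob_space ?H by (rule haar_stiefelD(1)[OF H])
  interpret U: prob_space ?U using n by (intro prob_space_uniform_count_measure) auto
  interpret P: pair_prob_space ?U ?H by unfold_locales
  have "?p \<in> borel_measurable (count_space {1..n} \<Otimes>\<^sub>M ?H)"
    by (rule measurable_pair_measure_countable1)
      (use projection_measurable haar_stiefelD(4)[OF H] in auto)
  moreover have "sets (count_space {1..n} \<Otimes>\<^sub>M ?H) = sets (?U \<Otimes>\<^sub>M ?H)"
    by (intro sets_pair_measure_cong) (auto simp: sets_uniform_count_measure)
  ultimately have p [measurable]: "?p \<in> borel_measurable (?U \<Otimes>\<^sub>M ?H)"
    using measurable_cong_sets by blast
  have law: "distr M borel X = distr (?U \<Otimes>\<^sub>M ?H) borel ?p"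
  proof (rule measure_eqI)
    fix B assume "B \<in> sets (distr M borel X)"
    then have B [measurable]: "B \<in> sets borel" by simp
    have "emeasure (distr M borel X) B = emeasure M {\<omega> \<in> space M. \<theta> \<omega> \<in> space stiefel_borel \<and> X \<omega> \<in> B}"
      using measurable_space[OF \<theta>] by (subst emeasure_distr) (auto intro!: arg_cong[where f="emeasure M"])
    also have "\<dots> = (\<integral>\<^sup>+ t\<in>space stiefel_borel. emeasure (proj_empirical n x t) B \<partial>?H)"
      using cond B unfolding conditional_law_def by blast
    also have "\<dots> = (\<integral>\<^sup>+ t. emeasure (proj_empirical n x t) B \<partial>?H)"
      by (intro nn_integral_cong) (auto simp: space_restrict_space)
    also have "\<dots> = (\<integral>\<^sup>+ t. emeasure ?U ((\<lambda>i. (i, t)) -` (?p -` B \<inter> space (?U \<Otimes>\<^sub>M ?H))) \<partial>?H)"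
    proof (rule nn_integral_cong)
      fix t assume "t \<in> space ?H"
      then have "(\<lambda>i. (i, t)) -` (?p -` B \<inter> space (?U \<Otimes>\<^sub>M ?H)) = (\<lambda>i. \<chi> j. t $ j \<bullet> x i) -` B \<inter> space ?U"
        by (auto simp: space_pair_measure)
      then show "emeasure (proj_empirical n x t) B =
          emeasure ?U ((\<lambda>i. (i, t)) -` (?p -` B \<inter> space (?U \<Otimes>\<^sub>M ?H)))"
        unfolding proj_empirical_def
        by (subst emeasure_distr) (auto simp: measurable_def sets_uniform_count_measure space_uniform_count_measure)
    qed
    also have "\<dots> = emeasure (?U \<Otimes>\<^sub>M ?H) (?p -` B \<inter> space (?U \<Otimes>\<^sub>M ?H))"
      by (rule P.emeasure_pair_measure_alt2[OF measurable_sets[OF p B], symmetric])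
    also have "\<dots> = emeasure (distr (?U \<Otimes>\<^sub>M ?H) borel ?p) B"
      by (rule emeasure_distr[OF p B, symmetric])
    finally show "emeasure (distr M borel X) B = emeasure (distr (?U \<Otimes>\<^sub>M ?H) borel ?p) B" .
  qed simp
  let ?D = "c + CARD('k) * (\<Sum>i=1..n. norm (x i))"
  have int: "integrable (?U \<Otimes>\<^sub>M ?H) (\<lambda>q. \<phi> (?p q))"
  proof (rule P.P.integrable_const_bound[where B="?D"], rule AE_I2)
    fix q assume q: "q \<in> space (?U \<Otimes>\<^sub>M ?H)"
    obtain i t where it: "q = (i, t)" by (cases q)
    have i: "i \<in> {1..n}" and t: "t \<in> stiefel"
      using q haar_stiefelD(2)[OF H] by (auto simp: it space_pair_measure space_uniform_count_measure)
    have "norm (?p q) \<le> CARD('k) * norm (x i)"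
      using norm_projection_le[OF t] by (simp add: it)
    also have "\<dots> \<le> CARD('k) * (\<Sum>i=1..n. norm (x i))"
      using i by (intro mult_left_mono member_le_sum) auto
    finally show "norm (\<phi> (?p q)) \<le> ?D" using growth[of "?p q"] by simp
  qed (rule measurable_compose[OF p], simp)
  then have "integrable (distr M borel X) \<phi>"
    unfolding law using integrable_distr_eq[OF p, of \<phi>] by simp
  then show "integrable M (\<lambda>\<omega>. \<phi> (X \<omega>))"
    by (subst (asm) integrable_distr_eq) auto
  have "(\<integral>\<omega>. \<phi> (X \<omega>) \<partial>M) = (\<integral>v. \<phi> v \<partial>distr M borel X)"
    by (subst integral_distr) auto
  also have "\<dots> = (\<integral>q. \<phi> (?p q) \<partial>(?U \<Otimes>\<^sub>M ?H))"
    unfolding law by (rule integral_distr[OF p]) simp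
  also have "\<dots> = (\<integral>i. (\<integral>t. \<phi> (?p (i, t)) \<partial>?H) \<partial>?U)"
    by (rule P.integral_fst'[OF int, symmetric])
  also have "\<dots> = (\<Sum>i=1..n. \<integral>t. \<phi> (\<chi> j. t $ j \<bullet> x i) \<partial>?H) / real n"
    by (subst integral_uniform_count_measure) auto
  finally show "(\<integral>\<omega>. \<phi> (X \<omega>) \<partial>M) =
      (\<Sum>i=1..n. \<integral>t. \<phi> (\<chi> j. t $ j \<bullet> x i) \<partial>?H) / real n" .
qed

text \<open>
  The same column serves for both radii, which couples the two laws at cost \<open>\<bar>p - q\<bar>\<close> times the mean length.
\<close>

lemma stiefel_column_rescaling_bound:
  fixes H :: "(real^'d^'k) measure"
  assumes H: "haar_stiefel H" and f: "1-lipschitz_on UNIV f"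
  shows "\<bar>(\<integral>\<theta>. f (p *\<^sub>R column a \<theta>) \<partial>H) - (\<integral>\<theta>. f (q *\<^sub>R column a \<theta>) \<partial>H)\<bar>
    \<le> \<bar>p - q\<bar> * sqrt (real CARD('k) / real CARD('d))"
proof -
  note W = stiefel_column_norm_integrable[OF H, of a]
  have int: "integrable H (\<lambda>\<theta>. f (p *\<^sub>R column a \<theta>))" for p
    by (rule integrable_Lipschitz[OF haar_stiefelD(1)[OF H] f]) (use W in auto)
  have "norm (\<integral>\<theta>. f (p *\<^sub>R column a \<theta>) - f (q *\<^sub>R column a \<theta>) \<partial>H) \<le> (\<integral>\<theta>. \<bar>p - q\<bar> * norm (column a \<theta>) \<partial>H)"
  proof (rule lebesgue_integral_norm_bound)
    show "norm (f (p *\<^sub>R column a \<theta>) - f (q *\<^sub>R column a \<theta>)) \<le> \<bar>p - q\<bar> * norm (column a \<theta>)" for \<theta>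
      using Lipschitz_bound(1)[OF f, of "p *\<^sub>R column a \<theta>" "q *\<^sub>R column a \<theta>"]
      by (simp flip: scaleR_left_diff_distrib)
  qed (use int W in auto)
  also have "\<dots> \<le> \<bar>p - q\<bar> * sqrt (real CARD('k) / real CARD('d))"
    using W(3) by (simp add: mult_left_mono)
  finally show ?thesis using int by simp
qed

lemma abs_diff_le_diff_squares:
  fixes p q :: real
  assumes "0 \<le> p" "0 < q"
  shows "\<bar>p - q\<bar> \<le> \<bar>p\<^sup>2 - q\<^sup>2\<bar> / q"
proof -
  have "\<bar>p - q\<bar> * q \<le> \<bar>p - q\<bar> * (p + q)" using assms by (intro mult_left_mono) auto
  also have "\<dots> = \<bar>(p - q) * (p + q)\<bar>" using assms by (simp add: abs_mult)
  also have "(p - q) * (p + q) = p\<^sup>2 - q\<^sup>2" by (simp add: power2_eq_square algebra_simps)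
  finally show ?thesis using assms by (simp add: pos_le_divide_eq)
qed

theorem theorem7:
  fixes n :: nat and x :: "nat \<Rightarrow> real^'d" and \<sigma> A :: real
    and M :: "'a measure" and \<theta> :: "'a \<Rightarrow> real^'d^'k" and X :: "'a \<Rightarrow> real^'k"
    and N :: "'b measure" and Z :: "'b \<Rightarrow> real^'k"
  assumes "CARD('d) \<ge> 2" and "CARD('k) \<le> CARD('d)" and "n \<ge> 1"
    and "\<sigma> > 0" and "(1 / real n) * (\<Sum>i=1..n. (norm (x i))\<^sup>2) = \<sigma>\<^sup>2 * real CARD('d)"
    and "A = (1 / real n) * (\<Sum>i=1..n. \<bar>(norm (x i))\<^sup>2 / \<sigma>\<^sup>2 - real CARD('d)\<bar>)"
    and "prob_space M" and "haar_stiefel (distr M stiefel_borel \<theta>)"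
    and "conditional_law M stiefel_borel \<theta> borel X (proj_empirical n x)"
    and "prob_space N" and "std_normal_vector N Z"
  shows "wasserstein M X N (\<lambda>\<omega>. \<sigma> *\<^sub>R Z \<omega>) \<le>
    ereal ((\<sigma> * sqrt (real CARD('k)) * (A + 1) + \<sigma> * real CARD('k)) / (real CARD('d) - 1))"
proof -
  define d k where "d = real CARD('d)" and "k = real CARD('k)"
  let ?H = "distr M stiefel_borel \<theta>"
  let ?bound = "(\<sigma> * sqrt k * (A + 1) + \<sigma> * k) / (d - 1)"
  \<comment> \<open>Any column will do, since all have the same law.\<close>
  obtain a :: 'd where True by blast
  note H = assms(8) and N = assms(10) and Z = assms(11)
  note expectation_X = expectation_conditional_law_proj_empirical[OF assms(3,8,9)]
  have d: "d \<ge> 2" and k: "k > 0" and \<sigma>: "\<sigma> > 0" and n: "real n > 0"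
    using assms(1,3,4) by (auto simp: d_def k_def)
  have X_meas: "X \<in> borel_measurable M" using assms(9) by (simp add: conditional_law_def)
  have int_X: "integrable M X"
    using expectation_X(1)[of norm 0] X_meas by (simp add: integrable_norm_iff)
  have Z_meas: "Z \<in> borel_measurable N" by (rule std_normal_vector_measurable[OF Z])
  have int_Z: "integrable N (\<lambda>\<omega>. \<sigma> *\<^sub>R Z \<omega>)"
    using integrable_norm_of_square[OF prob_space.finite_measure[OF N] Z_meas
        std_normal_vector_square_integrable[OF Z]] Z_meas
    by (intro integrable_scaleR_right) (simp add: integrable_norm_iff)
  have "\<bar>(\<integral>\<omega>. f (\<sigma> *\<^sub>R Z \<omega>) \<partial>N) - (\<integral>\<omega>. f (X \<omega>) \<partial>M)\<bar> \<le> ?bound"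
    if f: "1-lipschitz_on UNIV f" for f
  proof -
    let ?E = "\<lambda>r. \<integral>t. f (r *\<^sub>R column a t) \<partial>?H"
    let ?q = "\<sigma> * sqrt d"
    have E_X: "(\<integral>\<omega>. f (X \<omega>) \<partial>M) = (\<Sum>i=1..n. ?E (norm (x i))) / n"
      using expectation_X(2)[OF Lipschitz_bound(3,2)[OF f]]
        haar_stiefel_inner_law[OF H Lipschitz_bound(3)[OF f], of _ a] by simp
    \<comment> \<open>The length of \<open>x i\<close> is compared with the common radius \<open>\<sigma> sqrt d\<close>; averaging these errors gives the \<open>A\<close> term.\<close>
    have term_bound: "\<bar>?E (norm (x i)) - ?E ?q\<bar> \<le> \<sigma> * sqrt k / d * \<bar>(norm (x i))\<^sup>2 / \<sigma>\<^sup>2 - d\<bar>" for i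
    proof -
      have "\<bar>?E (norm (x i)) - ?E ?q\<bar> \<le> \<bar>norm (x i) - ?q\<bar> * sqrt (k / d)"
        unfolding k_def d_def by (rule stiefel_column_rescaling_bound[OF H f])
      also have "\<dots> \<le> \<bar>(norm (x i))\<^sup>2 - ?q\<^sup>2\<bar> / ?q * sqrt (k / d)"
        using abs_diff_le_diff_squares[of "norm (x i)" ?q] \<sigma> d k by (intro mult_right_mono) auto
      also have "(norm (x i))\<^sup>2 - ?q\<^sup>2 = \<sigma>\<^sup>2 * ((norm (x i))\<^sup>2 / \<sigma>\<^sup>2 - d)"
        using \<sigma> d by (simp add: power_mult_distrib field_simps)
      also have "\<bar>\<dots>\<bar> / ?q * sqrt (k / d) = \<sigma> * sqrt k / d * \<bar>(norm (x i))\<^sup>2 / \<sigma>\<^sup>2 - d\<bar>"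
        using \<sigma> d by (simp add: abs_mult real_sqrt_divide power2_eq_square)
      finally show ?thesis .
    qed
    have "(\<integral>\<omega>. f (X \<omega>) \<partial>M) - ?E ?q = (\<Sum>i=1..n. ?E (norm (x i)) - ?E ?q) / n"
      unfolding E_X using n by (simp add: sum_subtractf diff_divide_distrib)
    also have "\<bar>\<dots>\<bar> \<le> (\<Sum>i=1..n. \<sigma> * sqrt k / d * \<bar>(norm (x i))\<^sup>2 / \<sigma>\<^sup>2 - d\<bar>) / n"
      unfolding abs_divide abs_of_nat
      by (intro divide_right_mono order_trans[OF sum_abs] sum_mono term_bound) auto
    also have "\<dots> = \<sigma> * sqrt k / d * A"
      unfolding assms(6) d_def sum_distrib_left sum_divide_distrib by (simp add: mult_ac)
    also have "\<dots> \<le> \<sigma> * sqrt k / (d - 1) * A"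
    proof -
      have "A \<ge> 0" unfolding assms(6) by (simp add: sum_nonneg)
      then show ?thesis using \<sigma> d k by (intro mult_right_mono divide_left_mono) auto
    qed
    finally have radial: "\<bar>(\<integral>\<omega>. f (X \<omega>) \<partial>M) - ?E ?q\<bar> \<le> \<sigma> * sqrt k / (d - 1) * A" .
    \<comment> \<open>Scaling by \<open>\<sigma>\<close> reduces the comparison at radius \<open>\<sigma> sqrt d\<close> to the case of unit variance.\<close>
    have "1-lipschitz_on UNIV (\<lambda>v. f (\<sigma> *\<^sub>R v) / \<sigma>)"
    proof (rule lipschitz_onI)
      fix u v :: "real^'k"
      show "dist (f (\<sigma> *\<^sub>R u) / \<sigma>) (f (\<sigma> *\<^sub>R v) / \<sigma>) \<le> 1 * dist u v"
        using Lipschitz_bound(1)[OF f, of "\<sigma> *\<^sub>R u" "\<sigma> *\<^sub>R v"] \<sigma>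
        by (simp add: dist_norm divide_simps mult_ac flip: diff_divide_distrib scaleR_right_diff_distrib)
    qed simp
    from stiefel_column_gaussian_bound[OF H assms(1) N Z this, of a]
    have "\<bar>(\<integral>\<omega>. f (\<sigma> *\<^sub>R Z \<omega>) \<partial>N) - ?E ?q\<bar> / \<sigma> \<le> (k + sqrt k) / (d - 1)"
      using \<sigma> by (simp add: d_def k_def flip: diff_divide_distrib)
    then have gaussian: "\<bar>(\<integral>\<omega>. f (\<sigma> *\<^sub>R Z \<omega>) \<partial>N) - ?E ?q\<bar> \<le> \<sigma> * ((k + sqrt k) / (d - 1))"
      using \<sigma> by (simp add: pos_divide_le_eq mult.commute)
    have "\<bar>(\<integral>\<omega>. f (\<sigma> *\<^sub>R Z \<omega>) \<partial>N) - (\<integral>\<omega>. f (X \<omega>) \<partial>M)\<bar>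
        \<le> \<sigma> * ((k + sqrt k) / (d - 1)) + \<sigma> * sqrt k / (d - 1) * A"
      using radial gaussian by linarith
    also have "\<dots> = ?bound" by (simp add: add_divide_distrib algebra_simps)
    finally show ?thesis .
  qed
  then show ?thesis
    unfolding wasserstein_def using int_X int_Z by (auto intro!: SUP_least simp: d_def k_def)
qed

end
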